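(* $\mathbb F_0=\mathbb F_{\sqrt{1+x^2}}=\mathbb F_{\sqrt x}\cap\mathbb F_{TR}$. That is, a real number is an origami number if and only if it is constructible by compass and straightedge and is a totally real algebraic number.
   Context: An origami pair is a pair $(\mathcal P,\mathcal L)$ where $\mathcal P\subset\mathbb R^2$ is a set of points and $\mathcal L$ is a collection of lines in $\mathbb R^2$ such that: (i) the intersection point of any two non-parallel lines of $\mathcal L$ lies in $\mathcal P$; (ii) for any two distinct points of $\mathcal P$, the line through them is in $\mathcal L$; (iii) for any two distinct points of $\mathcal P$, the perpendicular bisector of the segment joining them is in $\mathcal L$; (iv) if $L_1,L_2\in\mathcal L$, then every line equidistant from $L_1$ and $L_2$ is in $\mathcal L$ (the midline if they are parallel, the angle bisectors if they intersect); (v) if $L_1,L_2\in\mathcal L$, then the mirror reflection of $L_2$ across $L_1$ is in $\mathcal L$. A set $\mathcal P\subset\mathbb R^2$ is closed under origami constructions if there is a collection of lines $\mathcal L$ with $(\mathcal P,\mathcal L)$ an origami pair. The set of origami constructible points is $\mathcal P_0=\bigcap\{\mathcal P : (0,0),(0,1)\in\mathcal P \text{ and } \mathcal P \text{ is closed under origami constructions}\}$. The set of origami numbers is $\mathbb F_0=\{\alpha\in\mathbb R : \exists v_1,v_2\in\mathcal P_0,\ |\alpha|=\operatorname{dist}(v_1,v_2)\}$. $\mathbb F_{\sqrt{1+x^2}}$ denotes the smallest subfield of $\mathbb C$ that, together with any element $x$, contains a square root of $1+x^2$. $\mathbb F_{\sqrt x}$ denotes the smallest subfield of $\mathbb C$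 that contains a square root of each of its elements. An algebraic number is totally real if all roots of its minimal polynomial over $\mathbb Q$ are real; $\mathbb F_{TR}$ denotes the set of totally real algebraic numbers. *)

theory Defs
  imports "HOL-Analysis.Analysis" "HOL-Computational_Algebra.Polynomial"
begin

text \<open>The plane R^2 is modelled as the complex numbers; the point (x,y) is x + i y.
  Lines are sets of points.\<close>

definition line_through :: "complex \<Rightarrow> complex \<Rightarrow> complex set" where
  "line_through a b = {z. \<exists>t::real. z = a + of_real t * (b - a)}"

definition is_line :: "complex set \<Rightarrow> bool" where
  "is_line L \<longleftrightarrow> (\<exists>a b. a \<noteq> b \<and> L = line_through a b)"

text \<open>Two lines are parallel iff one is a translate of the other (includes equal lines).\<close>
definition parallel_lines :: "complex set \<Rightarrow> complex set \<Rightarrow> bool" where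
  "parallel_lines L1 L2 \<longleftrightarrow> (\<exists>c. L2 = (\<lambda>z. z + c) ` L1)"

definition perp_bisector :: "complex \<Rightarrow> complex \<Rightarrow> complex set" where
  "perp_bisector a b = {z. dist z a = dist z b}"

definition reflect_across :: "complex \<Rightarrow> complex \<Rightarrow> complex \<Rightarrow> complex" where
  "reflect_across a b z = a + (b - a) * cnj ((z - a) / (b - a))"

definition origami_pair :: "complex set \<Rightarrow> complex set set \<Rightarrow> bool" where
  "origami_pair P \<L> \<longleftrightarrow>
     (\<forall>L\<in>\<L>. is_line L) \<and>
     (\<forall>L1\<in>\<L>. \<forall>L2\<in>\<L>. \<not> parallel_lines L1 L2 \<longrightarrow> L1 \<inter> L2 \<subseteq> P) \<and>
     (\<forall>a\<in>P. \<forall>b\<in>P. a \<noteq> b \<longrightarrow> line_through a b \<in> \<L>) \<and>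
     (\<forall>a\<in>P. \<forall>b\<in>P. a \<noteq> b \<longrightarrow> perp_bisector a b \<in> \<L>) \<and>
     (\<forall>L1\<in>\<L>. \<forall>L2\<in>\<L>. L1 \<noteq> L2 \<longrightarrow>
        (\<forall>L. is_line L \<and> (\<forall>z\<in>L. infdist z L1 = infdist z L2) \<longrightarrow> L \<in> \<L>)) \<and>
     (\<forall>L1\<in>\<L>. \<forall>L2\<in>\<L>. \<forall>a b. a \<noteq> b \<and> L1 = line_through a b \<longrightarrow>
        reflect_across a b ` L2 \<in> \<L>)"

definition origami_closed :: "complex set \<Rightarrow> bool" where
  "origami_closed P \<longleftrightarrow> (\<exists>\<L>. origami_pair P \<L>)"

definition origami_points :: "complex set" where
  "origami_points = \<Inter>{P. 0 \<in> P \<and> \<i> \<in> P \<and> origami_closed P}"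

definition origami_numbers :: "real set" where
  "origami_numbers = {\<alpha>. \<exists>v1\<in>origami_points. \<exists>v2\<in>origami_points. \<bar>\<alpha>\<bar> = dist v1 v2}"

definition is_subfield :: "complex set \<Rightarrow> bool" where
  "is_subfield K \<longleftrightarrow> 0 \<in> K \<and> 1 \<in> K \<and>
     (\<forall>x\<in>K. \<forall>y\<in>K. x + y \<in> K \<and> x - y \<in> K \<and> x * y \<in> K) \<and>
     (\<forall>x\<in>K. x \<noteq> 0 \<longrightarrow> inverse x \<in> K)"

definition F_sqrt_1_plus_sq :: "complex set" where
  "F_sqrt_1_plus_sq = \<Inter>{K. is_subfield K \<and> (\<forall>x\<in>K. \<exists>y\<in>K. y\<^sup>2 = 1 + x\<^sup>2)}"

definition F_sqrt :: "complex set" where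
  "F_sqrt = \<Inter>{K. is_subfield K \<and> (\<forall>x\<in>K. \<exists>y\<in>K. y\<^sup>2 = x)}"

definition is_min_poly :: "rat poly \<Rightarrow> complex \<Rightarrow> bool" where
  "is_min_poly p x \<longleftrightarrow> lead_coeff p = 1 \<and> irreducible p \<and> poly (map_poly of_rat p) x = 0"

definition is_totally_real :: "complex \<Rightarrow> bool" where
  "is_totally_real x \<longleftrightarrow> algebraic x \<and>
     (\<forall>p. is_min_poly p x \<longrightarrow> (\<forall>z::complex. poly (map_poly of_rat p) z = 0 \<longrightarrow> z \<in> \<real>))"

definition F_TR :: "complex set" where
  "F_TR = {x. is_totally_real x}"

end

theory Submission
  imports Defs "HOL-Computational_Algebra.Fundamental_Theorem_Algebra"
begin

text \<open>
  Write \<open>F\<close> for the smallest Pythagorean field. If \<open>x\<close> is constructible and totally real but not in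
  \<open>F\<close>, then some totally real \<open>t\<close> outside \<open>F\<close> has its square in \<open>F\<close>: an intermediate field of a tower
  of quadratic extensions contains a quadratic extension of the base. The square \<open>d = t^2\<close> is
  totally positive, and Artin's theorem that \<open>d\<close> is then a sum of squares has an explicit proof. Let
  \<open>p\<close> be the minimal polynomial of \<open>d\<close> and \<open>q = X p' mod p\<close>. The roots of \<open>p\<close> are real and \<open>q / p\<close> has
  positive residues, so the Euclidean algorithm (a Sturm chain) writes \<open>p' q - p q'\<close> as a sum of
  squares with positive rational weights, and its value at \<open>d\<close> is \<open>d p'(d)^2\<close>. So \<open>t\<close> lies in the
  Pythagorean field \<open>F\<close> after all.

  For the converse inclusion, an element of a quadratic tower over the rationals is totally real iff
  its images under all embeddings of the tower are real, a condition visibly stable under the field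
  operations and under \<open>sqrt (1 + x^2)\<close>.

  In the plane, the points with coordinates in \<open>F\<close> form an origami set, because normalising the
  equation of a line only needs \<open>sqrt (a^2 + b^2)\<close>; conversely the axis coordinates of any origami set form a
  Pythagorean field, the square root coming from an angle bisector.
\<close>

section \<open>Minimal polynomials and totally real numbers\<close>

abbreviation cpoly :: "rat poly \<Rightarrow> complex poly" where
  "cpoly \<equiv> map_poly of_rat"

lemma cpoly_add: "cpoly (p + q) = cpoly p + cpoly q"
  by (intro poly_eqI) (simp add: coeff_map_poly of_rat_add)

lemma cpoly_diff: "cpoly (p - q) = cpoly p - cpoly q"
  by (intro poly_eqI) (simp add: coeff_map_poly of_rat_diff)

lemma cpoly_mult: "cpoly (p * q) = cpoly p * cpoly q"
  by (intro poly_eqI) (simp add: coeff_map_poly coeff_mult of_rat_sum of_rat_mult)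

lemma cpoly_smult: "cpoly (smult a p) = smult (of_rat a) (cpoly p)"
  by (intro poly_eqI) (simp add: coeff_map_poly of_rat_mult)

lemma cpoly_power: "cpoly (p ^ n) = cpoly p ^ n"
  by (induction n) (simp_all add: cpoly_mult)

lemma cpoly_pderiv: "cpoly (pderiv p) = pderiv (cpoly p)"
proof (intro poly_eqI)
  fix n
  have "of_rat (of_nat (Suc n) * coeff p (Suc n))
      = of_nat (Suc n) * (of_rat (coeff p (Suc n)) :: complex)"
    by (simp only: of_rat_mult of_rat_of_nat_eq)
  then show "coeff (cpoly (pderiv p)) n = coeff (pderiv (cpoly p)) n"
    by (simp add: coeff_map_poly coeff_pderiv)
qed

lemma cpoly_eq_0_iff [simp]: "cpoly p = 0 \<longleftrightarrow> p = 0"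
  by (simp add: map_poly_eq_0_iff)

lemma degree_cpoly [simp]: "degree (cpoly p) = degree p"
  by (simp add: degree_map_poly)

lemma complex_of_rat_eq: "complex_of_rat q = complex_of_real (real_of_rat q)"
  by (cases q) (simp add: of_rat_rat)

lemma of_rat_in_Reals: "complex_of_rat q \<in> \<real>"
  by (simp add: complex_of_rat_eq)

lemma poly_cpoly_real:
  assumes "z \<in> \<real>"
  shows "poly (cpoly p) z \<in> \<real>"
  using assms
  by (auto simp: poly_altdef coeff_map_poly of_rat_in_Reals intro!: sum_in_Reals Reals_mult Reals_power)

lemma not_unit_of_root:
  assumes "p \<noteq> 0" "poly (cpoly p) x = 0"
  shows "\<not> is_unit p"
proof
  assume "is_unit p"
  then have "degree p = 0"
    using assms(1) by (simp add: is_unit_iff_degree)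
  then obtain c where "p = [:c:]"
    by (rule degree_eq_zeroE)
  then show False
    using assms by (simp add: map_poly_pCons)
qed

text \<open>A polynomial \<open>m\<close> of least degree vanishing at \<open>x\<close> divides
  every other one, by division with remainder. In particular it divides \<open>p\<close>, and
  irreducibility makes the two associated.\<close>

lemma irreducible_dvd_of_common_root:
  assumes irr: "irreducible (p :: rat poly)"
    and px: "poly (cpoly p) x = 0" and fx: "poly (cpoly f) x = 0"
  shows "p dvd f"
proof -
  let ?I = "{g. g \<noteq> 0 \<and> poly (cpoly g) x = 0}"
  have p0: "p \<noteq> 0"
    using irr by auto
  then have "p \<in> ?I"
    using px by simp
  then obtain m where m: "m \<in> ?I" and min: "\<And>g. g \<in> ?I \<Longrightarrow> degree m \<le> degree g"
    using arg_min_nat_lemma[of "\<lambda>g. g \<in> ?I" p degree] by blast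
  have dvd: "m dvd g" if "poly (cpoly g) x = 0" for g
  proof -
    have "cpoly g = cpoly (g div m) * cpoly m + cpoly (g mod m)"
      by (metis cpoly_add cpoly_mult div_mult_mod_eq)
    then have "poly (cpoly (g mod m)) x = 0"
      using that m by simp
    then have "g mod m = 0"
      using min[of "g mod m"] degree_mod_less[of m g] m by fastforce
    then show ?thesis by auto
  qed
  obtain k where k: "p = m * k"
    using dvd[OF px] by auto
  have "\<not> is_unit m"
    using m not_unit_of_root by blast
  then have "is_unit k"
    using irr k by (metis irreducibleD)
  then have "p dvd m"
    using k by (metis dvd_refl mult_unit_dvd_iff)
  then show ?thesis
    using dvd[OF fx] by (meson dvd_trans)
qed

text \<open>A nonzero annihilator of least degree is irreducible: one factor of a proper splitting
  would vanish at \<open>x\<close> and have smaller degree. Scaling makes it monic.\<close>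

lemma exists_is_min_poly:
  assumes "p \<noteq> 0" "poly (cpoly p) x = 0"
  shows "\<exists>m. is_min_poly m x"
proof -
  let ?I = "{g. g \<noteq> 0 \<and> poly (cpoly g) x = 0}"
  have "p \<in> ?I"
    using assms by simp
  then obtain m where m: "m \<in> ?I" and min: "\<And>g. g \<in> ?I \<Longrightarrow> degree m \<le> degree g"
    using arg_min_nat_lemma[of "\<lambda>g. g \<in> ?I" p degree] by blast
  have irr: "irreducible m"
  proof (rule irreducibleI)
    show "m \<noteq> 0" using m by simp
    show "\<not> is_unit m"
      using m not_unit_of_root by blast
    fix a b assume ab: "m = a * b"
    have nz: "a \<noteq> 0" "b \<noteq> 0" using ab m by auto
    have deg: "degree m = degree a + degree b"
      using ab nz by (simp add: degree_mult_eq)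
    have "a \<in> ?I \<or> b \<in> ?I"
      using m nz ab by (auto simp: cpoly_mult)
    then have "degree b = 0 \<or> degree a = 0"
      using min[of a] min[of b] deg by auto
    then show "is_unit a \<or> is_unit b"
      using nz by (auto simp: is_unit_iff_degree)
  qed
  define c where "c = inverse (lead_coeff m)"
  have c: "c \<noteq> 0" using m by (simp add: c_def)
  have "is_unit [:c:]"
    using c by (simp add: is_unit_const_poly_iff dvd_field_iff)
  then have "irreducible (smult c m)"
    using irr irreducible_mult_unit_left[of "[:c:]" m] by simp
  then have "is_min_poly (smult c m) x"
    using m c by (simp add: is_min_poly_def cpoly_smult c_def)
  then show ?thesis ..
qed

text \<open>Any annihilating polynomial may stand in for the minimal one, which divides it. Total
  reality is later obtained from norms, which need not be irreducible.\<close>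

lemma is_totally_real_iff:
  "is_totally_real x \<longleftrightarrow>
    (\<exists>p. p \<noteq> 0 \<and> poly (cpoly p) x = 0 \<and> (\<forall>z. poly (cpoly p) z = 0 \<longrightarrow> z \<in> \<real>))"
proof
  assume tr: "is_totally_real x"
  then obtain f where f: "\<forall>i. coeff f i \<in> \<rat>" "f \<noteq> 0" "poly f x = 0"
    by (auto simp: is_totally_real_def algebraic_altdef)
  then obtain g where "f = cpoly g"
    using ratpolyE by blast
  then obtain m where m: "is_min_poly m x"
    using f exists_is_min_poly[of g x] by auto
  then have "m \<noteq> 0" "poly (cpoly m) x = 0"
    by (auto simp: is_min_poly_def)
  then show "\<exists>p. p \<noteq> 0 \<and> poly (cpoly p) x = 0 \<and> (\<forall>z. poly (cpoly p) z = 0 \<longrightarrow> z \<in> \<real>)"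
    using tr m unfolding is_totally_real_def by blast
next
  assume "\<exists>p. p \<noteq> 0 \<and> poly (cpoly p) x = 0 \<and> (\<forall>z. poly (cpoly p) z = 0 \<longrightarrow> z \<in> \<real>)"
  then obtain p where p: "p \<noteq> 0" "poly (cpoly p) x = 0"
    "\<And>z. poly (cpoly p) z = 0 \<Longrightarrow> z \<in> \<real>"
    by blast
  have "algebraic x"
    unfolding algebraic_altdef using p by (intro exI[of _ "cpoly p"]) (simp add: coeff_map_poly)
  moreover have "z \<in> \<real>" if "is_min_poly m x" "poly (cpoly m) z = 0" for m z
  proof -
    have "m dvd p"
      using that p by (intro irreducible_dvd_of_common_root[of _ x]) (auto simp: is_min_poly_def)
    then have "poly (cpoly p) z = 0"
      using that by (auto simp: cpoly_mult elim!: dvdE)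
    then show ?thesis by (rule p(3))
  qed
  ultimately show "is_totally_real x"
    by (auto simp: is_totally_real_def)
qed

text \<open>Separability in characteristic zero: otherwise \<open>p\<close> would divide its
  derivative, which is nonzero and of smaller degree.\<close>

lemma irreducible_root_simple:
  assumes irr: "irreducible (p :: rat poly)" and pz: "poly (cpoly p) z = 0"
  shows "poly (cpoly (pderiv p)) z \<noteq> 0"
proof
  assume "poly (cpoly (pderiv p)) z = 0"
  then have "p dvd pderiv p"
    by (rule irreducible_dvd_of_common_root[OF irr pz])
  moreover have "degree p \<noteq> 0"
    using irr by (metis irreducible_def is_unit_iff_degree)
  ultimately show False
    by (metis degree_pderiv dvd_imp_degree_le pderiv_eq_0_iff diff_less gr0I not_le zero_less_one)
qed

section \<open>Interlacing polynomials\<close>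

text \<open>Partial fractions: for a root \<open>z\<close>, \<open>A z\<close> is
  \<open>P / (X - z)\<close>, and the weights are the residues of \<open>Q / P\<close> at the simple
  roots of \<open>P\<close>. Both sides of the expansion have degree below the number of roots and
  agree at each root.\<close>

lemma lagrange_squarefree:
  fixes P Q :: "complex poly"
  assumes sf: "rsquarefree P" and deg: "degree Q < degree P"
  defines "Z \<equiv> {z. poly P z = 0}"
  defines "A \<equiv> \<lambda>z. smult (lead_coeff P) (\<Prod>y\<in>Z - {z}. [:- y, 1:])"
  shows "\<And>z. z \<in> Z \<Longrightarrow> P = [:- z, 1:] * A z"
    and "\<And>z. z \<in> Z \<Longrightarrow> poly (A z) z = poly (pderiv P) z"
    and "\<And>z. degree (A z) \<le> degree P \<and> (z \<in> Z \<longrightarrow> degree (A z) = degree P - 1 \<and> lead_coeff (A z) = lead_coeff P)"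
    and "Q = (\<Sum>z\<in>Z. smult (poly Q z / poly (pderiv P) z) (A z))"
    and "finite Z" "Z \<noteq> {}"
proof -
  have P0: "P \<noteq> 0"
    using sf by (simp add: rsquarefree_def)
  show fin: "finite Z"
    unfolding Z_def using P0 by (rule poly_roots_finite)
  have dec: "P = smult (lead_coeff P) (\<Prod>z\<in>Z. [:- z, 1:])"
    unfolding Z_def using complex_poly_decompose_rsquarefree[OF sf] by simp
  have card: "card Z = degree P"
  proof -
    have "degree P = degree (\<Prod>z\<in>Z. [:- z, 1:])"
      using P0 by (subst dec) simp
    also have "\<dots> = card Z"
      by (subst degree_prod_sum_eq) auto
    finally show ?thesis by simp
  qed
  then show "Z \<noteq> {}" using deg by auto
  show fac: "P = [:- z, 1:] * A z" if "z \<in> Z" for z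
  proof -
    have "(\<Prod>y\<in>Z. [:- y, 1:]) = [:- z, 1:] * (\<Prod>y\<in>Z - {z}. [:- y, 1:])"
      using fin that by (rule prod.remove)
    then show ?thesis
      by (subst dec) (simp add: A_def mult_smult_right)
  qed
  show deriv: "poly (A z) z = poly (pderiv P) z" if "z \<in> Z" for z
  proof -
    have "pderiv P = pderiv ([:- z, 1:] * A z)"
      using fac[OF that] by simp
    then have "pderiv P = [:- z, 1:] * pderiv (A z) + A z"
      by (simp only: pderiv_mult) (simp add: pderiv_pCons)
    then show ?thesis by simp
  qed
  have degA: "degree (A z) = card (Z - {z})" "lead_coeff (A z) = lead_coeff P" for z
  proof -
    have "lead_coeff (\<Prod>y\<in>Z - {z}. [:- y, 1:]) = 1"
      by (subst lead_coeff_prod) simp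
    then show "degree (A z) = card (Z - {z})" "lead_coeff (A z) = lead_coeff P"
      using P0 by (simp_all add: A_def degree_prod_sum_eq)
  qed
  show degA': "degree (A z) \<le> degree P \<and> (z \<in> Z \<longrightarrow> degree (A z) = degree P - 1 \<and> lead_coeff (A z) = lead_coeff P)" for z
    using degA[of z] card fin card_Diff_subset[of "{z}" Z]
    by (metis Diff_subset card_Diff_singleton card_mono)
  have van: "poly (A z) y = 0" if "z \<in> Z" "y \<in> Z" "y \<noteq> z" for z y
    using that fin by (auto simp: A_def poly_prod)
  have sz: "poly (pderiv P) z \<noteq> 0" if "z \<in> Z" for z
    using sf that by (auto simp: rsquarefree_roots Z_def)
  show "Q = (\<Sum>z\<in>Z. smult (poly Q z / poly (pderiv P) z) (A z))"
  proof (rule poly_eqI_degree[of Z])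
    fix y assume y: "y \<in> Z"
    have "poly (\<Sum>z\<in>Z. smult (poly Q z / poly (pderiv P) z) (A z)) y
        = (\<Sum>z\<in>Z. if z = y then poly Q y else 0)"
      unfolding poly_sum using y van deriv sz
      by (intro sum.cong) auto
    then show "poly Q y = poly (\<Sum>z\<in>Z. smult (poly Q z / poly (pderiv P) z) (A z)) y"
      using y fin by simp
  next
    show "degree Q < card Z" using deg card by simp
    have "degree (\<Sum>z\<in>Z. smult (poly Q z / poly (pderiv P) z) (A z)) \<le> degree P - 1"
      using degA' fin by (intro degree_sum_le) (auto intro: order.trans[OF degree_smult_le])
    then show "degree (\<Sum>z\<in>Z. smult (poly Q z / poly (pderiv P) z) (A z)) < card Z"
      using deg card by simp
  qed
qed

text \<open>The sign condition says that \<open>q / p\<close> has a positive residue at each root of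
  \<open>p\<close>: at a real root the residue \<open>q / p'\<close> has the sign of
  \<open>q * p'\<close>. It also forces the roots to be simple. \<open>Re\<close> only turns a real
  value into type \<open>real\<close>.\<close>

definition interlaced :: "rat poly \<Rightarrow> rat poly \<Rightarrow> bool" where
  "interlaced p q \<longleftrightarrow> degree q < degree p \<and>
    (\<forall>z. poly (cpoly p) z = 0 \<longrightarrow>
      z \<in> \<real> \<and> Re (poly (cpoly q) z * poly (cpoly (pderiv p)) z) > 0)"

lemma Re_nonneg_square_real: "z \<in> \<real> \<Longrightarrow> Re (z\<^sup>2) \<ge> 0 \<and> (z \<noteq> 0 \<longrightarrow> Re (z\<^sup>2) > 0)"
  by (auto elim!: Reals_cases simp flip: of_real_power)

text \<open>The residues of \<open>q / p\<close> are quotients of values of rational polynomials at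
  real points, so they are real; \<open>interlaced\<close> makes them positive.\<close>

lemma interlaced_weights:
  assumes "interlaced p q"
  defines "P \<equiv> cpoly p" and "Q \<equiv> cpoly q"
  obtains Z w A where "Z = {z. poly P z = 0}" "finite Z" "Z \<noteq> {}"
    "\<And>z. z \<in> Z \<Longrightarrow> P = [:- z, 1:] * A z"
    "\<And>z. z \<in> Z \<Longrightarrow> degree (A z) = degree P - 1 \<and> lead_coeff (A z) = lead_coeff P"
    "\<And>z. z \<in> Z \<Longrightarrow> w z > 0"
    "Q = (\<Sum>z\<in>Z. smult (complex_of_real (w z)) (A z))"
proof -
  have deg: "degree Q < degree P"
    and roots: "\<And>z. poly P z = 0 \<Longrightarrow> z \<in> \<real> \<and> Re (poly Q z * poly (pderiv P) z) > 0"
    using assms by (auto simp: interlaced_def cpoly_pderiv)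
  \<comment> \<open>At a multiple root \<open>pderiv P\<close> would vanish, and with it the product
    known to be positive.\<close>
  have "rsquarefree P"
    unfolding rsquarefree_roots using roots by fastforce
  note lagrange = lagrange_squarefree[OF this deg]
  define Z where "Z = {z. poly P z = 0}"
  define A where "A z = smult (lead_coeff P) (\<Prod>y\<in>Z - {z}. [:- y, 1:])" for z
  note L = lagrange[folded Z_def, folded A_def]
  define w where "w = (\<lambda>z. Re (poly Q z / poly (pderiv P) z))"
  have w: "poly Q z / poly (pderiv P) z = complex_of_real (w z) \<and> w z > 0" if "z \<in> Z" for z
  proof -
    have z: "z \<in> \<real>" "Re (poly Q z * poly (pderiv P) z) > 0"
      using roots that by (auto simp: Z_def)
    obtain a b where ab: "poly Q z = complex_of_real a" "poly (pderiv P) z = complex_of_real b"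
      using poly_cpoly_real[OF z(1)] unfolding P_def Q_def cpoly_pderiv[symmetric]
      by (meson Reals_cases)
    then show ?thesis
      using z(2) by (auto simp: w_def zero_less_mult_iff zero_less_divide_iff
          simp flip: of_real_divide)
  qed
  show ?thesis
  proof (rule that[OF Z_def L(5,6)])
    show "Q = (\<Sum>z\<in>Z. smult (complex_of_real (w z)) (A z))"
      using L(4) w by (simp cong: sum.cong)
    show "degree (A z) = degree P - 1 \<and> lead_coeff (A z) = lead_coeff P" if "z \<in> Z" for z
      using L(3) that by blast
    show "w z > 0" if "z \<in> Z" for z
      using w that by blast
    show "P = [:- z, 1:] * A z" if "z \<in> Z" for z
      using L(1) that .
  qed
qed

lemma pderiv_sum: "pderiv (sum f S) = (\<Sum>i\<in>S. pderiv (f i))"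
  by (induction S rule: infinite_finite_induct) (simp_all add: pderiv_add)

text \<open>Everything follows from \<open>q / p\<close> being a sum of terms
  \<open>w / (X - z)\<close> with \<open>w > 0\<close> and \<open>z\<close> real. The third
  conclusion is the interlacing condition for \<open>q\<close> and the negated remainder of
  \<open>p\<close> modulo \<open>q\<close>.\<close>

lemma interlaced_step:
  assumes int: "interlaced p q"
  shows "degree q = degree p - 1" and "lead_coeff q / lead_coeff p > 0"
    and "\<And>s. poly (cpoly q) s = 0 \<Longrightarrow>
      s \<in> \<real> \<and> Re (- poly (cpoly p) s * poly (cpoly (pderiv q)) s) > 0"
proof -
  define P where "P = cpoly p"
  define Q where "Q = cpoly q"
  obtain Z w A where Z: "Z = {z. poly P z = 0}" "finite Z" "Z \<noteq> {}"
    and fac: "\<And>z. z \<in> Z \<Longrightarrow> P = [:- z, 1:] * A z"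
    and degA: "\<And>z. z \<in> Z \<Longrightarrow> degree (A z) = degree P - 1 \<and> lead_coeff (A z) = lead_coeff P"
    and w: "\<And>z. z \<in> Z \<Longrightarrow> w z > 0"
    and Q: "Q = (\<Sum>z\<in>Z. smult (complex_of_real (w z)) (A z))"
    by (rule interlaced_weights[OF int, folded P_def Q_def]) (rule that; assumption?)
  have deg: "degree q < degree p"
    using int by (simp add: interlaced_def)
  have real: "z \<in> \<real>" "poly Q z \<noteq> 0" if "z \<in> Z" for z
    using int that by (fastforce simp: interlaced_def Z P_def Q_def)+
  \<comment> \<open>In this degree each \<open>A z\<close> contributes the leading coefficient of
    \<open>P\<close>, so the weights add up. Their sum is positive, hence the coefficient of
    \<open>q\<close> cannot vanish.\<close>
  have "coeff (A z) (degree p - 1) = lead_coeff P" if "z \<in> Z" for z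
    using degA[OF that] by (metis P_def degree_cpoly)
  then have "coeff Q (degree p - 1) = (\<Sum>z\<in>Z. complex_of_real (w z) * lead_coeff P)"
    unfolding Q coeff_sum by (intro sum.cong) auto
  also have "\<dots> = of_real (sum w Z) * lead_coeff P"
    by (simp add: sum_distrib_right)
  finally have top: "coeff Q (degree p - 1) = of_real (sum w Z) * lead_coeff P" .
  have pos: "sum w Z > 0"
    using w Z by (intro sum_pos) auto
  have lc: "lead_coeff P = complex_of_real (real_of_rat (lead_coeff p))"
    by (simp add: P_def coeff_map_poly complex_of_rat_eq)
  have p0: "lead_coeff p \<noteq> 0" using deg by auto
  have "real_of_rat (coeff q (degree p - 1)) = sum w Z * real_of_rat (lead_coeff p)"
    using top unfolding lc by (simp add: Q_def coeff_map_poly complex_of_rat_eq flip: of_real_mult of_real_sum)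
  then have ratio: "real_of_rat (coeff q (degree p - 1) / lead_coeff p) = sum w Z"
    using p0 by (simp add: of_rat_divide)
  then have ratio_pos: "coeff q (degree p - 1) / lead_coeff p > 0"
    using pos by (metis zero_less_of_rat_iff)
  then have "coeff q (degree p - 1) \<noteq> 0" by auto
  then show dq: "degree q = degree p - 1"
    using deg le_degree[of q "degree p - 1"] by linarith
  show "lead_coeff q / lead_coeff p > 0"
    using ratio_pos dq by simp
  show "s \<in> \<real> \<and> Re (- poly (cpoly p) s * poly (cpoly (pderiv q)) s) > 0"
    if "poly (cpoly q) s = 0" for s
  proof -
    have s: "poly Q s = 0" using that by (simp add: Q_def)
    then have sZ: "s \<notin> Z" using real by auto
    have As: "poly P s = (s - z) * poly (A z) s" "poly (A z) s \<noteq> 0" if "z \<in> Z" for z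
    proof -
      show "poly P s = (s - z) * poly (A z) s"
        by (subst fac[OF that]) (simp add: algebra_simps)
      then show "poly (A z) s \<noteq> 0"
        using sZ by (auto simp: Z)
    qed
    \<comment> \<open>Each summand is a nonnegative multiple of \<open>cnj s - z\<close> with
      \<open>z\<close> real, so \<open>q / p\<close> exchanges the two half-planes. Since
      \<open>Q\<close> vanishes at \<open>s\<close>, this forces \<open>Im s = 0\<close>.\<close>
    have "Im (cnj (poly P s) * poly Q s)
        = (\<Sum>z\<in>Z. - Im s * (w z * (cmod (poly (A z) s))\<^sup>2))"
      unfolding Q poly_sum sum_distrib_left Im_sum
    proof (intro sum.cong refl)
      fix z assume z: "z \<in> Z"
      have "cnj (poly P s) * poly (smult (complex_of_real (w z)) (A z)) s
        = of_real (w z) * (cnj s - cnj z) * (poly (A z) s * cnj (poly (A z) s))"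
        using As(1)[OF z] by simp
      also have "\<dots> = of_real (w z * (cmod (poly (A z) s))\<^sup>2) * (cnj s - z)"
        using real(1)[OF z] by (simp add: complex_norm_square[symmetric] Reals_cnj_iff)
      finally have eq: "cnj (poly P s) * poly (smult (complex_of_real (w z)) (A z)) s
        = of_real (w z * (cmod (poly (A z) s))\<^sup>2) * (cnj s - z)" .
      show "Im (cnj (poly P s) * poly (smult (complex_of_real (w z)) (A z)) s)
        = - Im s * (w z * (cmod (poly (A z) s))\<^sup>2)"
        unfolding eq using real(1)[OF z]
        by (simp only: times_complex.simps Im_complex_of_real Re_complex_of_real)
          (simp add: complex_is_Real_iff)
    qed
    then have "Im s * (\<Sum>z\<in>Z. w z * (cmod (poly (A z) s))\<^sup>2) = 0"
      unfolding sum_distrib_left[symmetric] using s by simp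
    moreover have "(\<Sum>z\<in>Z. w z * (cmod (poly (A z) s))\<^sup>2) > 0"
      using Z w As(2) by (intro sum_pos) auto
    ultimately have sr: "s \<in> \<real>"
      by (simp add: complex_is_Real_iff)
    \<comment> \<open>For \<open>P = l * A\<close> with \<open>l' = 1\<close> the expression
      \<open>P' * A - P * A'\<close> collapses to the square of \<open>A\<close>; the weights carry
      this over to \<open>Q\<close>.\<close>
    have W: "pderiv P * Q - P * pderiv Q = (\<Sum>z\<in>Z. smult (complex_of_real (w z)) ((A z)\<^sup>2))"
    proof -
      have "pderiv Q = (\<Sum>z\<in>Z. smult (complex_of_real (w z)) (pderiv (A z)))"
        unfolding Q by (simp add: pderiv_sum pderiv_smult)
      then have "pderiv P * Q - P * pderiv Q
        = (\<Sum>z\<in>Z. smult (complex_of_real (w z)) (pderiv P * A z - P * pderiv (A z)))"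
        by (simp add: Q sum_distrib_left sum_subtractf smult_diff_right)
      also have "\<dots> = (\<Sum>z\<in>Z. smult (complex_of_real (w z)) ((A z)\<^sup>2))"
      proof (intro sum.cong refl)
        fix z assume z: "z \<in> Z"
        define l where "l = [:- z, 1:]"
        have P: "P = l * A z"
          using fac[OF z] by (simp only: l_def)
        have "pderiv l = 1"
          by (simp add: l_def pderiv_pCons)
        then have "pderiv P = A z + l * pderiv (A z)"
          unfolding P pderiv_mult by simp
        then have "pderiv P * A z - P * pderiv (A z) = (A z)\<^sup>2"
          by (simp add: P algebra_simps power2_eq_square)
        then show "smult (complex_of_real (w z)) (pderiv P * A z - P * pderiv (A z))
          = smult (complex_of_real (w z)) ((A z)\<^sup>2)" by simp
      qed
      finally show ?thesis .
    qed
    have Pr: "poly P s \<in> \<real>"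
      using poly_cpoly_real[OF sr] by (simp add: P_def)
    have "- (poly P s * poly (pderiv Q) s) = poly (pderiv P * Q - P * pderiv Q) s"
      using s by simp
    also have "\<dots> = (\<Sum>z\<in>Z. of_real (w z) * (poly (A z) s)\<^sup>2)"
      unfolding W by (simp add: poly_sum)
    finally have "Re (- (poly P s * poly (pderiv Q) s)) = (\<Sum>z\<in>Z. w z * Re ((poly (A z) s)\<^sup>2))"
      by simp
    also have "\<dots> > 0"
    proof (intro sum_pos)
      fix z assume z: "z \<in> Z"
      have "s \<noteq> z"
        using sZ z by auto
      then have "poly (A z) s = poly P s / (s - z)"
        using As(1)[OF z] by simp
      then have "poly (A z) s \<in> \<real>"
        using Pr sr real(1)[OF z] by simp
      then show "0 < w z * Re ((poly (A z) s)\<^sup>2)"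
        using Re_nonneg_square_real As(2)[OF z] w[OF z] by simp
    qed (use Z in auto)
    finally show ?thesis
      using sr by (simp add: P_def Q_def cpoly_pderiv)
  qed
qed

text \<open>The weights are kept apart from the squares, so that all polynomials stay rational; a
  Pythagorean field absorbs them because it contains square roots of the nonnegative
  rationals.\<close>

inductive pos_sum_squares :: "rat poly \<Rightarrow> bool" where
  zero: "pos_sum_squares 0"
| add_square: "pos_sum_squares g \<Longrightarrow> \<alpha> > 0 \<Longrightarrow> pos_sum_squares (smult \<alpha> (f\<^sup>2) + g)"

text \<open>One division step \<open>p = a q - r\<close> changes \<open>p' q - p q'\<close> into \<open>a' q^2 + (q' r - q r')\<close>.\<close>
lemma wronskian_pos_sum_squares:
  assumes "interlaced p q"
  shows "pos_sum_squares (pderiv p * q - p * pderiv q)"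
  using assms
proof (induction "degree p" arbitrary: p q rule: less_induct)
  case less
  note step = interlaced_step[OF less.prems]
  have deg: "degree q < degree p"
    using less.prems by (simp add: interlaced_def)
  have q0: "q \<noteq> 0"
    using step(2) by auto
  define a where "a = p div q"
  \<comment> \<open>The sign gives \<open>r\<close> the value of \<open>- p\<close> at the roots of
    \<open>q\<close>, as the interlacing of \<open>q\<close> and \<open>r\<close> requires.\<close>
  define r where "r = - (p mod q)"
  have pr: "p = a * q - r"
    by (simp add: a_def r_def)
  have dr: "r = 0 \<or> degree r < degree q"
    unfolding r_def using degree_mod_less[OF q0, of p] by auto
  then have "degree r < degree p"
    using deg by auto
  moreover have aq: "a * q = r + p"
    by (simp add: pr)
  ultimately have aq': "degree (a * q) = degree p" "lead_coeff (a * q) = lead_coeff p"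
    by (metis degree_add_eq_right, metis lead_coeff_add_le)
  have a0: "a \<noteq> 0"
    using aq'(1) deg by auto
  \<comment> \<open>The degree falls by exactly one from \<open>p\<close> to \<open>q\<close>, so
    the quotient is linear. Its derivative is a constant, positive by the ratio of leading
    coefficients.\<close>
  then have dega: "degree a = 1"
    using q0 step(1) deg aq'(1) by (simp add: degree_mult_eq)
  define \<alpha> where "\<alpha> = lead_coeff a"
  have "pderiv a = [:\<alpha>:]"
  proof (rule poly_eqI)
    show "coeff (pderiv a) n = coeff [:\<alpha>:] n" for n
      using dega by (cases n) (auto simp: coeff_pderiv \<alpha>_def coeff_eq_0)
  qed
  moreover have "\<alpha> = inverse (lead_coeff q / lead_coeff p)"
    using q0 aq'(2) by (simp add: \<alpha>_def lead_coeff_mult field_simps)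
  then have "\<alpha> > 0"
    using step(2) by (simp only: inverse_positive_iff_positive)
  ultimately have \<alpha>: "pderiv a = [:\<alpha>:]" "\<alpha> > 0"
    by auto
  have "pderiv p * q - p * pderiv q = smult \<alpha> (q\<^sup>2) + (pderiv q * r - q * pderiv r)"
    unfolding pr by (simp add: pderiv_mult pderiv_diff \<alpha> algebra_simps power2_eq_square)
  moreover have "pos_sum_squares (pderiv q * r - q * pderiv r)"
  proof (cases "r = 0")
    case True
    then show ?thesis by (simp add: pos_sum_squares.zero)
  next
    case False
    have "interlaced q r"
      unfolding interlaced_def
    proof (intro conjI allI impI)
      fix s assume s: "poly (cpoly q) s = 0"
      have "poly (cpoly r) s = - poly (cpoly p) s"
        using s by (simp add: pr cpoly_diff cpoly_mult)
      then show "s \<in> \<real>" "0 < Re (poly (cpoly r) s * poly (cpoly (pderiv q)) s)"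
        using step(3)[OF s] by auto
    qed (use dr False in auto)
    then show ?thesis
      using less.hyps deg by blast
  qed
  ultimately show ?case
    using \<alpha>(2) by (simp add: pos_sum_squares.add_square)
qed

section \<open>Square roots in Pythagorean fields\<close>

definition pythagorean :: "complex set \<Rightarrow> bool" where
  "pythagorean K \<longleftrightarrow> is_subfield K \<and> (\<forall>x\<in>K. \<exists>y\<in>K. y\<^sup>2 = 1 + x\<^sup>2)"

section \<open>Arithmetic in subfields of the complex numbers\<close>

lemma
  assumes "is_subfield K"
  shows subfield_0: "0 \<in> K" and subfield_1: "1 \<in> K"
    and subfield_add: "\<And>x y. x \<in> K \<Longrightarrow> y \<in> K \<Longrightarrow> x + y \<in> K"
    and subfield_diff: "\<And>x y. x \<in> K \<Longrightarrow> y \<in> K \<Longrightarrow> x - y \<in> K"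
    and subfield_mult: "\<And>x y. x \<in> K \<Longrightarrow> y \<in> K \<Longrightarrow> x * y \<in> K"
  using assms by (auto simp: is_subfield_def)

lemma subfield_inverse: "is_subfield K \<Longrightarrow> x \<in> K \<Longrightarrow> inverse x \<in> K"
  by (cases "x = 0") (auto simp: is_subfield_def)

lemma subfield_uminus: "is_subfield K \<Longrightarrow> x \<in> K \<Longrightarrow> - x \<in> K"
  using subfield_diff[of K 0 x] subfield_0[of K] by simp

lemma subfield_divide: "is_subfield K \<Longrightarrow> x \<in> K \<Longrightarrow> y \<in> K \<Longrightarrow> x / y \<in> K"
  by (simp add: divide_inverse subfield_mult subfield_inverse)

lemma subfield_power: "is_subfield K \<Longrightarrow> x \<in> K \<Longrightarrow> x ^ n \<in> K"
  by (induction n) (auto simp: subfield_1 subfield_mult)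

lemma subfield_sum: "is_subfield K \<Longrightarrow> (\<And>i. i \<in> S \<Longrightarrow> f i \<in> K) \<Longrightarrow> sum f S \<in> K"
  by (induction S rule: infinite_finite_induct) (auto simp: subfield_0 subfield_add)

lemma subfield_of_nat: "is_subfield K \<Longrightarrow> of_nat n \<in> K"
  by (induction n) (auto simp: subfield_0 subfield_1 subfield_add)

lemma subfield_of_int: "is_subfield K \<Longrightarrow> of_int n \<in> K"
  by (cases n) (auto intro: subfield_of_nat subfield_diff subfield_uminus subfield_add subfield_1)

lemma subfield_of_rat: "is_subfield K \<Longrightarrow> of_rat q \<in> K"
  by (cases q) (auto simp: of_rat_rat intro: subfield_divide subfield_of_int)

lemma subfield_Rats: "is_subfield \<rat>"
  by (auto simp: is_subfield_def)

lemma Rats_subset_subfield: "is_subfield K \<Longrightarrow> \<rat> \<subseteq> K"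
  by (auto elim!: Rats_cases simp: subfield_of_rat)

lemmas subfield_intros = subfield_0 subfield_1 subfield_add subfield_diff subfield_mult
  subfield_inverse subfield_uminus subfield_divide subfield_power

lemma subfield_cpoly: "is_subfield K \<Longrightarrow> x \<in> K \<Longrightarrow> poly (cpoly f) x \<in> K"
  by (auto simp: poly_altdef coeff_map_poly
      intro!: subfield_sum subfield_mult subfield_of_rat subfield_power)

text \<open>Homogenisation: for nonzero \<open>x\<close>, factor out \<open>x^2\<close> and take the
  root of \<open>1 + (y / x)^2\<close>.\<close>

lemma pythagorean_add_squares:
  assumes K: "pythagorean K" and x: "x \<in> K" and y: "y \<in> K"
  shows "\<exists>z\<in>K. z\<^sup>2 = x\<^sup>2 + y\<^sup>2"
proof (cases "x = 0")
  case False
  have sf: "is_subfield K" using K by (simp add: pythagorean_def)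
  have "y / x \<in> K" by (rule subfield_divide[OF sf y x])
  then obtain u where u: "u \<in> K" "u\<^sup>2 = 1 + (y / x)\<^sup>2"
    using K by (auto simp: pythagorean_def)
  have "(x * u)\<^sup>2 = x\<^sup>2 + y\<^sup>2"
    using False by (simp add: power_mult_distrib u power_divide field_simps)
  then show ?thesis using u x sf by (metis subfield_mult)
qed (use y in auto)

text \<open>Induction through \<open>n + 1 = 1 + z^2\<close> with \<open>z^2 = n\<close>.\<close>

lemma pythagorean_sqrt_of_nat:
  assumes "pythagorean K"
  shows "\<exists>z\<in>K. z\<^sup>2 = of_nat n"
proof (induction n)
  case 0
  then show ?case using assms by (auto simp: pythagorean_def subfield_0 intro!: bexI[of _ 0])
next
  case (Suc n)
  then show ?case using assms unfolding pythagorean_def by (metis of_nat_Suc)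
qed

lemma pythagorean_sqrt_of_rat:
  assumes K: "pythagorean K" and "q \<ge> 0"
  shows "\<exists>z\<in>K. z\<^sup>2 = of_rat q"
proof (cases q)
  case (Fract a b)
  have sf: "is_subfield K" using K by (simp add: pythagorean_def)
  have "a \<ge> 0"
    using Rat.zero_le_Fract_iff[OF Fract(2), of a] assms(2) Fract(1) by simp
  then obtain m n where mn: "a = int m" "b = int n"
    using Fract by (metis nonneg_int_cases order_less_imp_le)
  obtain u v where "u \<in> K" "u\<^sup>2 = of_nat m" "v \<in> K" "v\<^sup>2 = of_nat n"
    using pythagorean_sqrt_of_nat[OF K] by metis
  then have "u / v \<in> K" "(u / v)\<^sup>2 = of_rat q"
    using Fract mn sf by (auto simp: power_divide of_rat_rat subfield_divide)
  then show ?thesis by blast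
qed

lemma pythagorean_sqrt_pos_sum_squares:
  assumes "pos_sum_squares g" and K: "pythagorean K" and x: "x \<in> K"
  shows "\<exists>z\<in>K. z\<^sup>2 = poly (cpoly g) x"
  using assms(1)
proof induction
  case zero
  then show ?case using K by (auto simp: pythagorean_def subfield_0 intro!: bexI[of _ 0])
next
  case (add_square g \<alpha> f)
  have sf: "is_subfield K" using K by (simp add: pythagorean_def)
  obtain z where z: "z \<in> K" "z\<^sup>2 = poly (cpoly g) x"
    using add_square by blast
  obtain u where u: "u \<in> K" "u\<^sup>2 = of_rat \<alpha>"
    using pythagorean_sqrt_of_rat[OF K, of \<alpha>] add_square by auto
  obtain w where w: "w \<in> K" "w\<^sup>2 = (u * poly (cpoly f) x)\<^sup>2 + z\<^sup>2"
    using pythagorean_add_squares[OF K, of "u * poly (cpoly f) x" z] u z x sf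
    by (metis subfield_mult subfield_cpoly)
  then have "w\<^sup>2 = poly (cpoly (smult \<alpha> (f\<^sup>2) + g)) x"
    by (simp add: cpoly_add cpoly_smult cpoly_power u z power_mult_distrib)
  then show ?case using w by blast
qed

text \<open>Artin's theorem in explicit form. The residues of \<open>q / p\<close> are the positive
  conjugates of \<open>d\<close>, so the Wronskian of \<open>p\<close> and \<open>q\<close> is a
  weighted sum of squares; its value at \<open>d\<close> is \<open>d\<close> times a nonzero
  square.\<close>

lemma pythagorean_sqrt_totally_positive:
  assumes K: "pythagorean K" and d: "d \<in> K"
    and p: "is_min_poly p d"
    and roots: "\<And>z. poly (cpoly p) z = 0 \<Longrightarrow> z \<in> \<real> \<and> Re z > 0"
  shows "\<exists>y\<in>K. y\<^sup>2 = d"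
proof -
  have sf: "is_subfield K" using K by (simp add: pythagorean_def)
  have irr: "irreducible p" and pd: "poly (cpoly p) d = 0"
    using p by (auto simp: is_min_poly_def)
  have p0: "p \<noteq> 0" using irr by auto
  have degp: "degree p > 0"
    using irr p0 by (metis gr0I irreducible_def is_unit_iff_degree)
  \<comment> \<open>At a root \<open>z\<close> of \<open>p\<close> the remainder still takes the
    value \<open>z * p' z\<close>, so the residue of \<open>q / p\<close> there is \<open>z\<close>
    itself. Reducing brings the degree below that of \<open>p\<close>.\<close>
  define q where "q = ([:0, 1:] * pderiv p) mod p"
  have q: "poly (cpoly q) z = z * poly (cpoly (pderiv p)) z" if "poly (cpoly p) z = 0" for z
  proof -
    have "cpoly ([:0, 1:] * pderiv p) = cpoly (([:0, 1:] * pderiv p) div p) * cpoly p + cpoly q"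
      unfolding q_def by (metis cpoly_add cpoly_mult div_mult_mod_eq)
    then have "poly (cpoly ([:0, 1:] * pderiv p)) z = poly (cpoly q) z"
      using that by simp
    then show ?thesis
      unfolding cpoly_mult by (simp add: map_poly_pCons)
  qed
  have "interlaced p q"
    unfolding interlaced_def
  proof (intro conjI allI impI)
    show "degree q < degree p"
      unfolding q_def using degree_mod_less[OF p0] degp by (metis degree_0)
    fix z assume z: "poly (cpoly p) z = 0"
    show zr: "z \<in> \<real>" using roots z by blast
    obtain b where b: "poly (cpoly (pderiv p)) z = complex_of_real b"
      using poly_cpoly_real[OF zr] by (meson Reals_cases)
    have "b \<noteq> 0" using irreducible_root_simple[OF irr z] b by auto
    moreover have "poly (cpoly q) z * poly (cpoly (pderiv p)) z = of_real (b\<^sup>2) * z"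
      using q[OF z] b by (simp add: power2_eq_square)
    ultimately show "0 < Re (poly (cpoly q) z * poly (cpoly (pderiv p)) z)"
      using roots[OF z] by simp
  qed
  then have "pos_sum_squares (pderiv p * q - p * pderiv q)"
    by (rule wronskian_pos_sum_squares)
  then obtain y where y: "y \<in> K" "y\<^sup>2 = poly (cpoly (pderiv p * q - p * pderiv q)) d"
    using pythagorean_sqrt_pos_sum_squares[OF _ K d] by blast
  define c where "c = poly (cpoly (pderiv p)) d"
  have "y\<^sup>2 = d * c\<^sup>2"
    using y(2) q[OF pd] pd by (simp add: cpoly_diff cpoly_mult c_def power2_eq_square)
  moreover have "c \<noteq> 0"
    using irreducible_root_simple[OF irr pd] by (simp add: c_def)
  ultimately have "(y / c)\<^sup>2 = d"
    by (simp add: power_divide)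
  moreover have "y / c \<in> K"
    unfolding c_def using y d sf by (intro subfield_divide subfield_cpoly)
  ultimately show ?thesis by blast
qed

text \<open>The split into even and odd parts serves to express \<open>p z * p (- z)\<close> as a
  rational polynomial in \<open>z^2\<close>.\<close>

lemma rat_poly_even_odd: "\<exists>a b. (p :: rat poly) = pcompose a [:0, 0, 1:] + [:0, 1:] * pcompose b [:0, 0, 1:]"
proof (induction p)
  case 0
  show ?case by (intro exI[of _ 0]) simp
next
  case (pCons c p)
  then obtain a b where "p = pcompose a [:0, 0, 1:] + [:0, 1:] * pcompose b [:0, 0, 1:]"
    by blast
  then have "pCons c p = pcompose (pCons c b) [:0, 0, 1:] + [:0, 1:] * pcompose a [:0, 0, 1:]"
    by (simp add: pcompose_pCons algebra_simps)
  then show ?case by blast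
qed

lemma poly_cpoly_pcompose: "poly (cpoly (pcompose a b)) x = poly (cpoly a) (poly (cpoly b) x)"
  by (induction a) (simp_all add: pcompose_pCons cpoly_add cpoly_mult map_poly_pCons)

text \<open>For nonzero \<open>t\<close>, each conjugate of \<open>t^2\<close> is the square of a
  nonzero real number, so \<open>t^2\<close> is totally positive and has a root in \<open>K\<close>.
  That root is \<open>t\<close> up to sign.\<close>

lemma pythagorean_sqrt_totally_real:
  assumes K: "pythagorean K" and t: "is_totally_real t" and d: "t\<^sup>2 \<in> K"
  shows "t \<in> K"
proof (cases "t = 0")
  case True
  then show ?thesis using K by (simp add: pythagorean_def subfield_0)
next
  case False
  obtain p where p0: "p \<noteq> 0" and pt: "poly (cpoly p) t = 0"
    and pr: "\<And>z. poly (cpoly p) z = 0 \<Longrightarrow> z \<in> \<real>"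
    using t by (auto simp: is_totally_real_iff)
  obtain a b where ab: "p = pcompose a [:0, 0, 1:] + [:0, 1:] * pcompose b [:0, 0, 1:]"
    using rat_poly_even_odd by blast
  have pz: "poly (cpoly p) z = poly (cpoly a) (z\<^sup>2) + z * poly (cpoly b) (z\<^sup>2)" for z
    by (subst ab) (simp add: cpoly_add cpoly_mult poly_cpoly_pcompose map_poly_pCons power2_eq_square)
  \<comment> \<open>The value at \<open>z^2\<close> is \<open>p z * p (- z)\<close>, so every root
    of \<open>N\<close> is the square of a real root of \<open>p\<close>.\<close>
  define N where "N = a\<^sup>2 - [:0, 1:] * b\<^sup>2"
  have N: "poly (cpoly N) (z\<^sup>2) = poly (cpoly p) z * poly (cpoly p) (- z)" for z
    unfolding pz N_def
    by (simp add: cpoly_diff cpoly_mult cpoly_power map_poly_pCons power2_eq_square algebra_simps)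
  \<comment> \<open>Otherwise every complex number would be, up to sign, one of the finitely many
    roots of \<open>p\<close>.\<close>
  have N0: "N \<noteq> 0"
  proof
    assume "N = 0"
    then have "poly (cpoly p) z * poly (cpoly p) (- z) = 0" for z
      using N[of z] by simp
    then have "UNIV = {z. poly (cpoly p) z = 0} \<union> uminus ` {z. poly (cpoly p) z = 0}"
      by (auto simp: image_iff) (metis minus_minus)
    moreover have "finite {z. poly (cpoly p) z = 0}"
      using p0 by (intro poly_roots_finite) simp
    ultimately have "finite (UNIV :: complex set)"
      by (metis finite_UnI finite_imageI)
    then show False
      by (simp add: infinite_UNIV_char_0)
  qed
  have Nt: "poly (cpoly N) (t\<^sup>2) = 0" by (simp add: N pt)
  obtain m where m: "is_min_poly m (t\<^sup>2)"
    using exists_is_min_poly[OF N0 Nt] by blast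
  have irr: "irreducible m" and mt: "poly (cpoly m) (t\<^sup>2) = 0"
    using m by (auto simp: is_min_poly_def)
  have "m dvd N"
    by (rule irreducible_dvd_of_common_root[OF irr mt Nt])
  have "z \<in> \<real> \<and> Re z > 0" if z: "poly (cpoly m) z = 0" for z
  proof -
    obtain w where w: "z = w\<^sup>2"
      by (metis power2_csqrt)
    have "poly (cpoly N) (w\<^sup>2) = 0"
      using \<open>m dvd N\<close> z w by (auto simp: cpoly_mult elim!: dvdE)
    then have "w \<in> \<real> \<or> - w \<in> \<real>"
      using pr[of w] pr[of "- w"] unfolding N by (auto simp del: Reals_minus_iff)
    then have wr: "w \<in> \<real>"
      by simp
    \<comment> \<open>If 0 were a root, the irreducible \<open>m\<close> would divide
      \<open>X\<close>, and then \<open>t^2 = 0\<close>.\<close>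
    have "z \<noteq> 0"
    proof
      assume "z = 0"
      then have "m dvd [:0, 1:]"
        using z by (intro irreducible_dvd_of_common_root[OF irr]) (auto simp: map_poly_pCons)
      then have "poly (cpoly [:0, 1:]) (t\<^sup>2) = 0"
        using mt by (metis cpoly_mult dvdE mult_zero_left poly_mult)
      then show False using False by (simp add: map_poly_pCons)
    qed
    then show ?thesis
      using wr w Re_nonneg_square_real[OF wr] by auto
  qed
  then obtain y where y: "y \<in> K" "y\<^sup>2 = t\<^sup>2"
    using pythagorean_sqrt_totally_positive[OF K d m] by blast
  then have "t = y \<or> t = - y"
    by (metis power2_eq_iff)
  then show ?thesis
    using y K by (auto simp: pythagorean_def subfield_uminus)
qed

section \<open>Quadratic towers\<close>

text \<open>The span of 1 and \<open>s\<close> over \<open>K\<close>. It is the field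
  \<open>K(s)\<close> when \<open>s^2\<close> lies in \<open>K\<close>, which is how the steps of a
  tower arise.\<close>

definition adjoin_root :: "complex set \<Rightarrow> complex \<Rightarrow> complex set" where
  "adjoin_root K s = {a + b * s | a b. a \<in> K \<and> b \<in> K}"

lemma adjoin_rootI: "a \<in> K \<Longrightarrow> b \<in> K \<Longrightarrow> a + b * s \<in> adjoin_root K s"
  by (auto simp: adjoin_root_def)

lemma subset_adjoin_root: "is_subfield K \<Longrightarrow> K \<subseteq> adjoin_root K s"
  using adjoin_rootI[of _ K 0 s] by (auto simp: subfield_0)

lemma root_in_adjoin_root: "is_subfield K \<Longrightarrow> s \<in> adjoin_root K s"
  using adjoin_rootI[of 0 K 1 s] by (auto simp: subfield_0 subfield_1)

lemma adjoin_root_mono: "K \<subseteq> K' \<Longrightarrow> adjoin_root K s \<subseteq> adjoin_root K' s"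
  by (auto simp: adjoin_root_def)

lemma adjoin_root_subset: "is_subfield L \<Longrightarrow> K \<subseteq> L \<Longrightarrow> s \<in> L \<Longrightarrow> adjoin_root K s \<subseteq> L"
  by (auto simp: adjoin_root_def intro!: subfield_add subfield_mult)

lemma adjoin_root_absorb: "is_subfield K \<Longrightarrow> s \<in> K \<Longrightarrow> adjoin_root K s = K"
  using adjoin_root_subset[of K K s] subset_adjoin_root[of K s] by auto

lemma adjoin_root_unique:
  assumes K: "is_subfield K" and "s \<notin> K"
    and "a \<in> K" "b \<in> K" "a' \<in> K" "b' \<in> K" and eq: "a + b * s = a' + b' * s"
  shows "a = a' \<and> b = b'"
proof -
  have "b = b'"
  proof (rule ccontr)
    assume "b \<noteq> b'"
    then have "s = (a' - a) / (b - b')"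
      using eq by (simp add: field_simps)
    then show False
      using assms by (metis subfield_diff subfield_divide)
  qed
  then show ?thesis using eq by simp
qed

text \<open>Inverses come from rationalising the denominator: multiplying \<open>a + b * s\<close>
  by its conjugate gives a norm in \<open>K\<close>, nonzero because \<open>s\<close> is outside
  \<open>K\<close>.\<close>

lemma subfield_adjoin_root:
  assumes K: "is_subfield K" and d: "s\<^sup>2 \<in> K"
  shows "is_subfield (adjoin_root K s)"
proof (cases "s \<in> K")
  case True
  then show ?thesis using K by (simp add: adjoin_root_absorb)
next
  case False
  have "inverse x \<in> adjoin_root K s" if x: "x \<in> adjoin_root K s" "x \<noteq> 0" for x
  proof -
    obtain a b where ab: "x = a + b * s" "a \<in> K" "b \<in> K"
      using x by (auto simp: adjoin_root_def)
    have conj: "a - b * s \<noteq> 0"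
    proof
      assume "a - b * s = 0"
      then have "a = 0 \<and> b = 0"
        using adjoin_root_unique[OF K False ab(2,3) subfield_0[OF K] subfield_0[OF K]]
          adjoin_root_unique[OF K False ab(2) subfield_uminus[OF K ab(3)] subfield_0[OF K] subfield_0[OF K]]
        by simp
      then show False using ab x by simp
    qed
    define n where "n = a\<^sup>2 - b\<^sup>2 * s\<^sup>2"
    have n: "n = x * (a - b * s)"
      by (simp add: n_def ab algebra_simps power2_eq_square)
    have "n \<in> K"
      unfolding n_def
      using K d subfield_power[OF K ab(2), of 2] subfield_power[OF K ab(3), of 2]
      by (intro subfield_diff subfield_mult)
    moreover have "inverse x = (a - b * s) / n"
      using conj x by (simp add: n divide_inverse)
    then have "inverse x = a / n + (- b / n) * s"
      by (simp add: diff_divide_distrib)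
    moreover have "a / n \<in> K" "- b / n \<in> K"
      using K ab \<open>n \<in> K\<close> by (auto intro: subfield_divide subfield_uminus)
    ultimately show ?thesis
      using adjoin_rootI by metis
  qed
  moreover have "x + y \<in> adjoin_root K s \<and> x - y \<in> adjoin_root K s \<and> x * y \<in> adjoin_root K s"
    if xy: "x \<in> adjoin_root K s" "y \<in> adjoin_root K s" for x y
  proof -
    obtain a b c e where ab: "x = a + b * s" "a \<in> K" "b \<in> K" "y = c + e * s" "c \<in> K" "e \<in> K"
      using xy by (auto simp: adjoin_root_def)
    have "x + y = (a + c) + (b + e) * s" "x - y = (a - c) + (b - e) * s"
      "x * y = (a * c + b * e * s\<^sup>2) + (a * e + b * c) * s"
      by (simp_all add: ab algebra_simps power2_eq_square)
    moreover have "a + c \<in> K" "b + e \<in> K" "a - c \<in> K" "b - e \<in> K"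
      "a * c + b * e * s\<^sup>2 \<in> K" "a * e + b * c \<in> K"
      using ab d K by (auto intro!: subfield_add subfield_diff subfield_mult)
    ultimately show ?thesis by (metis adjoin_rootI)
  qed
  ultimately show ?thesis
    using subset_adjoin_root[OF K, of s] K
    by (auto simp: is_subfield_def)
qed

definition quad_step :: "complex set \<Rightarrow> complex set \<Rightarrow> bool" where
  "quad_step K K' \<longleftrightarrow> (\<exists>s. s\<^sup>2 \<in> K \<and> K' = adjoin_root K s)"

abbreviation quad_tower :: "complex set \<Rightarrow> complex set \<Rightarrow> bool" where
  "quad_tower \<equiv> quad_step\<^sup>*\<^sup>*"

lemma quad_tower_subfield:
  assumes "quad_tower B K" "is_subfield B"
  shows "is_subfield K \<and> B \<subseteq> K"
  using assms
proof induction
  case (step K K')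
  then show ?case
    using subfield_adjoin_root subset_adjoin_root unfolding quad_step_def by blast
qed auto

text \<open>The steps of the second tower are repeated on top of the first. Equal bases make the
  union of towers directed; different bases lift a tower over the rationals to a larger base
  field.\<close>

lemma quad_tower_directed:
  assumes "quad_tower B K" "quad_tower B' K'" "is_subfield B" "is_subfield B'" "B' \<subseteq> B"
  shows "\<exists>M. quad_tower B M \<and> K \<subseteq> M \<and> K' \<subseteq> M"
  using assms(2)
proof induction
  case base
  then show ?case
    using assms quad_tower_subfield by blast
next
  case (step K' K'')
  then obtain M where M: "quad_tower B M" "K \<subseteq> M" "K' \<subseteq> M" by blast
  obtain s where s: "s\<^sup>2 \<in> K'" "K'' = adjoin_root K' s"
    using step by (auto simp: quad_step_def)
  have "quad_step M (adjoin_root M s)"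
    using M s by (auto simp: quad_step_def)
  moreover have "M \<subseteq> adjoin_root M s"
    using M assms quad_tower_subfield subset_adjoin_root by blast
  ultimately show ?case
    using M s adjoin_root_mono[of K' M s] by (meson order_trans rtranclp.rtrancl_into_rtrancl)
qed

text \<open>Induction from the bottom of the tower replaces the usual argument with index-two subgroups of
  2-groups: if \<open>s\<close> generates the first step and \<open>t = a + b s\<close> is obtained for \<open>T(s)\<close>, then one of
  \<open>a\<close>, \<open>b\<close>, \<open>a^2 - s^2 b^2\<close> works for \<open>T\<close>.\<close>
lemma quad_tower_intermediate:
  assumes "quad_tower B K" "is_subfield B" "is_subfield T" "B \<subseteq> T" "x \<in> T" "x \<in> K" "x \<notin> B"
  shows "\<exists>t\<in>T. t \<notin> B \<and> t\<^sup>2 \<in> B"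
  using assms
proof (induction arbitrary: T rule: converse_rtranclp_induct)
  case base
  then show ?case by simp
next
  case (step B B1)
  obtain s where s: "s\<^sup>2 \<in> B" "B1 = adjoin_root B s"
    using step by (auto simp: quad_step_def)
  note B = \<open>is_subfield B\<close> and T = \<open>is_subfield T\<close>
  show ?case
  proof (cases "s \<in> T")
    case True
    show ?thesis
    proof (cases "s \<in> B")
      case True
      then have "B1 = B" using s B by (simp add: adjoin_root_absorb)
      then show ?thesis using step by blast
    next
      case False
      then show ?thesis using True s by blast
    qed
  next
    case False
    then have sB: "s \<notin> B" using step by blast
    have sT: "s\<^sup>2 \<in> T" using s step by blast
    \<comment> \<open>The induction hypothesis is used over \<open>B1\<close> with
      \<open>T(s)\<close> in the role of \<open>T\<close>. The element \<open>x\<close> stays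
      outside \<open>B1\<close> because its \<open>s\<close>-coordinate over \<open>T\<close> is
      0.\<close>
    define T1 where "T1 = adjoin_root T s"
    have "is_subfield T1" "is_subfield B1" "B1 \<subseteq> T1" "x \<in> T1"
      using subfield_adjoin_root[OF T sT] subfield_adjoin_root[OF B s(1)]
        adjoin_root_mono[OF \<open>B \<subseteq> T\<close>] subset_adjoin_root[OF T] \<open>x \<in> T\<close> s(2)
      by (auto simp: T1_def)
    moreover have "x \<notin> B1"
    proof
      assume "x \<in> B1"
      then obtain a b where ab: "x = a + b * s" "a \<in> B" "b \<in> B"
        using s by (auto simp: adjoin_root_def)
      then have "x + 0 * s = a + b * s" by simp
      then have "x = a"
        using adjoin_root_unique[OF T False \<open>x \<in> T\<close> subfield_0[OF T], of a b] ab \<open>B \<subseteq> T\<close> by blast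
      then show False using ab(2) \<open>x \<notin> B\<close> by blast
    qed
    ultimately obtain t where t: "t \<in> T1" "t \<notin> B1" "t\<^sup>2 \<in> B1"
      using step.IH[of T1] \<open>x \<in> K\<close> by blast
    obtain a b where ab: "t = a + b * s" "a \<in> T" "b \<in> T"
      using t by (auto simp: T1_def adjoin_root_def)
    obtain u v where uv: "t\<^sup>2 = u + v * s" "u \<in> B" "v \<in> B"
      using t s by (auto simp: adjoin_root_def)
    have "a\<^sup>2 + b\<^sup>2 * s\<^sup>2 \<in> T" "2 * a * b \<in> T"
      using ab sT subfield_add[OF T] subfield_mult[OF T] subfield_power[OF T]
        subfield_of_nat[OF T, of 2] by auto
    moreover have "(a\<^sup>2 + b\<^sup>2 * s\<^sup>2) + (2 * a * b) * s = u + v * s"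
      unfolding uv(1)[symmetric] by (simp add: ab algebra_simps power2_eq_square)
    ultimately have u: "a\<^sup>2 + b\<^sup>2 * s\<^sup>2 = u" and v: "2 * a * b = v"
      using adjoin_root_unique[OF T False] uv \<open>B \<subseteq> T\<close> by blast+
    have s0: "s \<noteq> 0" using sB subfield_0[OF B] by auto
    have nB: "\<not> (a \<in> B \<and> b \<in> B)"
      using t(2) ab(1) s(2) adjoin_rootI by blast
    \<comment> \<open>Three candidates: \<open>a\<close>, if its square lies in \<open>B\<close> but
      it does not; \<open>b\<close>, if \<open>a\<close> lies in \<open>B\<close>, which forces
      \<open>a = 0\<close>; and \<open>w\<close>, if \<open>a^2\<close> is outside
      \<open>B\<close>.\<close>
    show ?thesis
    proof (cases "a\<^sup>2 \<in> B")
      case True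
      show ?thesis
      proof (cases "a \<in> B")
        case aB: True
        then have "b \<notin> B" using nB by blast
        moreover have "a = 0"
        proof (rule ccontr)
          assume "a \<noteq> 0"
          then have "b = v / (of_nat 2 * a)" using v by auto
          then show False
            using \<open>b \<notin> B\<close> aB uv B by (metis subfield_divide subfield_mult subfield_of_nat)
        qed
        then have "b\<^sup>2 = u / s\<^sup>2" using u s0 by (auto simp: field_simps)
        then have "b\<^sup>2 \<in> B" using uv s B by (simp add: subfield_divide)
        ultimately show ?thesis using ab by blast
      next
        case False
        then show ?thesis using True ab by blast
      qed
    next
      case False
      \<comment> \<open>As \<open>u = a^2 + b^2 * s^2\<close>, this is
        \<open>a^2 - b^2 * s^2\<close>, the norm of \<open>t\<close> down to \<open>T\<close>. Its
        square is the norm of \<open>t^2\<close>, namely \<open>u^2 - s^2 * v^2\<close>, which lies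
        in \<open>B\<close>.\<close>
      define w where "w = of_nat 2 * a\<^sup>2 - u"
      have "a\<^sup>2 = (w + u) / of_nat 2" by (simp add: w_def)
      then have "w \<notin> B"
        using False uv B by (metis subfield_add subfield_divide subfield_of_nat)
      moreover have "w \<in> T"
        unfolding w_def using ab uv \<open>B \<subseteq> T\<close> T
        by (intro subfield_diff subfield_mult subfield_power subfield_of_nat) auto
      moreover have "w\<^sup>2 = u\<^sup>2 - s\<^sup>2 * v\<^sup>2"
        unfolding w_def u[symmetric] v[symmetric]
        by (simp add: algebra_simps power2_eq_square)
      then have "w\<^sup>2 \<in> B"
        using uv s B by (simp add: subfield_diff subfield_mult subfield_power)
      ultimately show ?thesis by blast
    qed
  qed
qed

section \<open>Embeddings of quadratic towers\<close>

text \<open>Only the restriction to \<open>K\<close> matters. The value at 1 excludes the zero map,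
  so these are the embeddings of \<open>K\<close>.\<close>

definition field_hom_on :: "complex set \<Rightarrow> (complex \<Rightarrow> complex) \<Rightarrow> bool" where
  "field_hom_on K \<sigma> \<longleftrightarrow> \<sigma> 1 = 1 \<and>
    (\<forall>x\<in>K. \<forall>y\<in>K. \<sigma> (x + y) = \<sigma> x + \<sigma> y \<and> \<sigma> (x * y) = \<sigma> x * \<sigma> y)"

lemma field_hom_on_add: "field_hom_on K \<sigma> \<Longrightarrow> x \<in> K \<Longrightarrow> y \<in> K \<Longrightarrow> \<sigma> (x + y) = \<sigma> x + \<sigma> y"
  and field_hom_on_mult: "field_hom_on K \<sigma> \<Longrightarrow> x \<in> K \<Longrightarrow> y \<in> K \<Longrightarrow> \<sigma> (x * y) = \<sigma> x * \<sigma> y"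
  and field_hom_on_1: "field_hom_on K \<sigma> \<Longrightarrow> \<sigma> 1 = 1"
  by (auto simp: field_hom_on_def)

context
  fixes K \<sigma>
  assumes K: "is_subfield K" and hom: "field_hom_on K \<sigma>"
begin

lemma field_hom_on_0: "\<sigma> 0 = 0"
  using field_hom_on_add[OF hom, of 0 0] subfield_0[OF K] by simp

lemma field_hom_on_diff:
  assumes "x \<in> K" "y \<in> K"
  shows "\<sigma> (x - y) = \<sigma> x - \<sigma> y"
  using field_hom_on_add[OF hom subfield_diff[OF K assms] assms(2)] by simp

lemma field_hom_on_uminus: "x \<in> K \<Longrightarrow> \<sigma> (- x) = - \<sigma> x"
  using field_hom_on_diff[of 0 x] subfield_0[OF K] by (simp add: field_hom_on_0)

lemma field_hom_on_inverse:
  assumes "x \<in> K"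
  shows "\<sigma> (inverse x) = inverse (\<sigma> x)"
proof (cases "x = 0")
  case False
  then have "\<sigma> x * \<sigma> (inverse x) = 1"
    using field_hom_on_mult[OF hom assms subfield_inverse[OF K assms]] field_hom_on_1[OF hom]
    by simp
  then show ?thesis
    by (metis inverse_unique)
qed (simp add: field_hom_on_0)

lemma field_hom_on_sum: "(\<And>i. i \<in> S \<Longrightarrow> f i \<in> K) \<Longrightarrow> \<sigma> (sum f S) = (\<Sum>i\<in>S. \<sigma> (f i))"
  by (induction S rule: infinite_finite_induct)
    (simp_all add: field_hom_on_0 field_hom_on_add[OF hom] subfield_sum[OF K])

lemma field_hom_on_of_nat: "\<sigma> (of_nat n) = of_nat n"
  by (induction n)
    (simp_all add: field_hom_on_0 field_hom_on_1[OF hom] field_hom_on_add[OF hom]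
      subfield_1[OF K] subfield_of_nat[OF K])

lemma field_hom_on_of_int: "\<sigma> (of_int n) = of_int n"
  using field_hom_on_uminus[OF subfield_of_nat[OF K, of "Suc m" for m]]
  by (cases n rule: int_cases) (simp_all add: field_hom_on_of_nat del: of_nat_Suc)

lemma field_hom_on_of_rat: "\<sigma> (of_rat q) = of_rat q"
  by (cases q) (simp add: of_rat_rat divide_inverse field_hom_on_mult[OF hom]
      field_hom_on_inverse field_hom_on_of_int subfield_of_int[OF K] subfield_inverse[OF K])

lemma field_hom_on_poly:
  assumes x: "x \<in> K"
  shows "\<sigma> (poly (cpoly p) x) = poly (cpoly p) (\<sigma> x)"
  using x
  by (induction p)
    (simp_all add: field_hom_on_0 map_poly_pCons field_hom_on_add[OF hom] field_hom_on_mult[OF hom]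
      field_hom_on_of_rat subfield_of_rat[OF K] subfield_mult[OF K] subfield_cpoly[OF K])

end

section \<open>Polynomials over a subfield and their images under embeddings\<close>

definition poly_over :: "complex set \<Rightarrow> complex poly \<Rightarrow> bool" where
  "poly_over K f \<longleftrightarrow> (\<forall>i. coeff f i \<in> K)"

lemma poly_over_mult: "is_subfield K \<Longrightarrow> poly_over K f \<Longrightarrow> poly_over K g \<Longrightarrow> poly_over K (f * g)"
  by (simp add: poly_over_def coeff_mult subfield_sum subfield_mult)

lemma poly_over_diff: "is_subfield K \<Longrightarrow> poly_over K f \<Longrightarrow> poly_over K g \<Longrightarrow> poly_over K (f - g)"
  by (simp add: poly_over_def subfield_diff)

lemma poly_over_smult: "is_subfield K \<Longrightarrow> c \<in> K \<Longrightarrow> poly_over K f \<Longrightarrow> poly_over K (smult c f)"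
  by (simp add: poly_over_def subfield_mult)

lemma map_poly_hom_on_mult:
  assumes K: "is_subfield K" and hom: "field_hom_on K \<sigma>" and f: "poly_over K f" and g: "poly_over K g"
  shows "map_poly \<sigma> (f * g) = map_poly \<sigma> f * map_poly \<sigma> g"
proof (rule poly_eqI)
  fix n
  have "\<sigma> (\<Sum>i\<le>n. coeff f i * coeff g (n - i)) = (\<Sum>i\<le>n. \<sigma> (coeff f i * coeff g (n - i)))"
    using f g K by (intro field_hom_on_sum[OF K hom]) (simp add: poly_over_def subfield_mult)
  also have "\<dots> = (\<Sum>i\<le>n. \<sigma> (coeff f i) * \<sigma> (coeff g (n - i)))"
    using f g by (intro sum.cong refl field_hom_on_mult[OF hom]) (auto simp: poly_over_def)
  finally show "coeff (map_poly \<sigma> (f * g)) n = coeff (map_poly \<sigma> f * map_poly \<sigma> g) n"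
    by (simp add: coeff_map_poly field_hom_on_0[OF K hom] coeff_mult)
qed

lemma map_poly_hom_on_diff:
  assumes K: "is_subfield K" and hom: "field_hom_on K \<sigma>" and f: "poly_over K f" and g: "poly_over K g"
  shows "map_poly \<sigma> (f - g) = map_poly \<sigma> f - map_poly \<sigma> g"
  using f g by (intro poly_eqI)
    (simp add: coeff_map_poly field_hom_on_0[OF K hom] field_hom_on_diff[OF K hom] poly_over_def)

lemma map_poly_hom_on_smult:
  assumes K: "is_subfield K" and hom: "field_hom_on K \<sigma>" and f: "poly_over K f" and c: "c \<in> K"
  shows "map_poly \<sigma> (smult c f) = smult (\<sigma> c) (map_poly \<sigma> f)"
  using f c by (intro poly_eqI)
    (simp add: coeff_map_poly field_hom_on_0[OF K hom] field_hom_on_mult[OF hom] poly_over_def)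

text \<open>The last clause expresses without Galois theory that no embedding is missing: norms down to
  the rationals are rational. Repetitions in the list are harmless.\<close>
definition complete_embeddings :: "complex set \<Rightarrow> (complex \<Rightarrow> complex) list \<Rightarrow> bool" where
  "complete_embeddings K \<Sigma> \<longleftrightarrow> (\<forall>\<sigma>\<in>set \<Sigma>. field_hom_on K \<sigma>) \<and>
    (\<exists>\<sigma>\<in>set \<Sigma>. \<forall>x\<in>K. \<sigma> x = x) \<and>
    (\<forall>f. poly_over K f \<longrightarrow> poly_over \<rat> (\<Prod>\<sigma>\<leftarrow>\<Sigma>. map_poly \<sigma> f))"

lemma complete_embeddings_Rats: "complete_embeddings \<rat> [id]"
  by (simp add: complete_embeddings_def field_hom_on_def)

lemma prod_list_concat_pairs:
  "prod_list (map F (concat (map (\<lambda>x. [u x, v x]) xs))) = (\<Prod>x\<leftarrow>xs. F (u x) * F (v x) :: 'a :: comm_monoid_mult)"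
  by (induction xs) (simp_all add: mult.assoc)

text \<open>Each embedding of \<open>K\<close> is extended in two ways, by the two signs of a root
  of the image of \<open>s^2\<close>. The two images of \<open>f\<close> multiply to the image of a
  polynomial over \<open>K\<close>, so completeness for \<open>K\<close> applies.\<close>

lemma complete_embeddings_adjoin_root:
  assumes K: "is_subfield K" and d: "s\<^sup>2 \<in> K" and s: "s \<notin> K" and \<Sigma>: "complete_embeddings K \<Sigma>"
  shows "\<exists>\<Sigma>'. complete_embeddings (adjoin_root K s) \<Sigma>'"
proof -
  \<comment> \<open>The pair of coordinates with respect to 1 and \<open>s\<close>, unique because
    \<open>s\<close> is outside \<open>K\<close>; its components become \<open>A\<close> and
    \<open>B\<close>.\<close>
  define D where "D x = (SOME ab. fst ab \<in> K \<and> snd ab \<in> K \<and> x = fst ab + snd ab * s)" for x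
  have D: "D (a + b * s) = (a, b)" if "a \<in> K" "b \<in> K" for a b
  proof -
    let ?P = "\<lambda>ab. fst ab \<in> K \<and> snd ab \<in> K \<and> a + b * s = fst ab + snd ab * s"
    have "?P (D (a + b * s))"
      unfolding D_def by (rule someI[of ?P "(a, b)"]) (use that in simp)
    then show ?thesis
      using adjoin_root_unique[OF K s that] by (metis prod.collapse)
  qed
  define A where "A x = fst (D x)" for x
  define B where "B x = snd (D x)" for x
  have AB: "A (a + b * s) = a" "B (a + b * s) = b" if "a \<in> K" "b \<in> K" for a b
    using D[OF that] by (simp_all add: A_def B_def)
  have AK: "A x \<in> K" "B x \<in> K" "x = A x + B x * s" if "x \<in> adjoin_root K s" for x
    using that AB by (auto simp: adjoin_root_def)
  have AB0: "A x = x" "B x = 0" if "x \<in> K" for x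
    using AB[OF that subfield_0[OF K]] by simp_all
  \<comment> \<open>The extension of \<open>\<sigma>\<close> sending \<open>s\<close> to
    \<open>c\<close>; it is multiplicative when \<open>c^2\<close> is the image of
    \<open>s^2\<close>.\<close>
  define ext where "ext c \<sigma> x = \<sigma> (A x) + c * \<sigma> (B x)" for c and \<sigma> :: "complex \<Rightarrow> complex" and x
  define c where "c \<sigma> = csqrt (\<sigma> (s\<^sup>2))" for \<sigma>
  define \<Sigma>' where "\<Sigma>' = concat (map (\<lambda>\<sigma>. [ext (c \<sigma>) \<sigma>, ext (- c \<sigma>) \<sigma>]) \<Sigma>)"
  have hom: "field_hom_on (adjoin_root K s) (ext e \<sigma>)"
    if \<sigma>: "field_hom_on K \<sigma>" and e: "e\<^sup>2 = \<sigma> (s\<^sup>2)" for e \<sigma>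
    unfolding field_hom_on_def
  proof (intro conjI ballI)
    show "ext e \<sigma> 1 = 1"
      using AB0[OF subfield_1[OF K]] field_hom_on_0[OF K \<sigma>] field_hom_on_1[OF \<sigma>]
      by (simp add: ext_def)
    fix x y assume "x \<in> adjoin_root K s" "y \<in> adjoin_root K s"
    then obtain a b a' b' where xy: "x = a + b * s" "y = a' + b' * s"
      and in_K: "a \<in> K" "b \<in> K" "a' \<in> K" "b' \<in> K"
      by (auto simp: adjoin_root_def)
    have "x + y = (a + a') + (b + b') * s"
      by (simp add: xy algebra_simps)
    moreover have "a + a' \<in> K" "b + b' \<in> K"
      using in_K K by (auto intro: subfield_add)
    ultimately have "A (x + y) = a + a'" "B (x + y) = b + b'"
      using AB by metis+
    then show "ext e \<sigma> (x + y) = ext e \<sigma> x + ext e \<sigma> y"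
      using in_K by (simp add: ext_def xy AB field_hom_on_add[OF \<sigma>] algebra_simps)
    have "x * y = (a * a' + b * b' * s\<^sup>2) + (a * b' + b * a') * s"
      by (simp add: xy algebra_simps power2_eq_square)
    moreover have "a * a' + b * b' * s\<^sup>2 \<in> K" "a * b' + b * a' \<in> K"
      using in_K K d by (auto intro!: subfield_add subfield_mult)
    ultimately have "A (x * y) = a * a' + b * b' * s\<^sup>2" "B (x * y) = a * b' + b * a'"
      using AB by metis+
    then have "ext e \<sigma> (x * y) = (\<sigma> a * \<sigma> a' + \<sigma> b * \<sigma> b' * e\<^sup>2) + e * (\<sigma> a * \<sigma> b' + \<sigma> b * \<sigma> a')"
      using in_K d by (simp add: ext_def e field_hom_on_add[OF \<sigma>] field_hom_on_mult[OF \<sigma>]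
          subfield_mult[OF K])
    then show "ext e \<sigma> (x * y) = ext e \<sigma> x * ext e \<sigma> y"
      using in_K by (simp add: ext_def xy AB algebra_simps power2_eq_square)
  qed
  have c2: "(c \<sigma>)\<^sup>2 = \<sigma> (s\<^sup>2)" for \<sigma>
    by (simp add: c_def)
  have "complete_embeddings (adjoin_root K s) \<Sigma>'"
    unfolding complete_embeddings_def
  proof (intro conjI ballI allI impI)
    fix \<tau> assume "\<tau> \<in> set \<Sigma>'"
    then show "field_hom_on (adjoin_root K s) \<tau>"
      using \<Sigma> c2 by (auto simp: \<Sigma>'_def complete_embeddings_def intro!: hom)
  next
    obtain \<sigma> where \<sigma>: "\<sigma> \<in> set \<Sigma>" "\<And>x. x \<in> K \<Longrightarrow> \<sigma> x = x"
      using \<Sigma> by (auto simp: complete_embeddings_def)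
    \<comment> \<open>The principal root may be \<open>- s\<close>. As both signs are listed in
      \<open>\<Sigma>'\<close>, the extension that fixes \<open>s\<close> occurs in any
      case.\<close>
    have "(c \<sigma>)\<^sup>2 = s\<^sup>2"
      using c2 \<sigma>(2)[OF d] by simp
    then have "s = c \<sigma> \<or> s = - c \<sigma>"
      by (metis power2_eq_iff)
    then have "ext s \<sigma> \<in> set \<Sigma>'"
      using \<sigma>(1) by (auto simp: \<Sigma>'_def)
    moreover have "ext s \<sigma> x = x" if "x \<in> adjoin_root K s" for x
      using AK[OF that] \<sigma>(2) by (simp add: ext_def mult.commute)
    ultimately show "\<exists>\<tau>\<in>set \<Sigma>'. \<forall>x\<in>adjoin_root K s. \<tau> x = x"
      by blast
  next
    fix f assume f: "poly_over (adjoin_root K s) f"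
    define g where "g = map_poly A f"
    define h where "h = map_poly B f"
    have AB00: "A 0 = 0" "B 0 = 0"
      using AB0[OF subfield_0[OF K]] by auto
    have gh: "poly_over K g" "poly_over K h"
      using f AK AB00 by (auto simp: poly_over_def g_def h_def coeff_map_poly)
    \<comment> \<open>With \<open>f = g + s * h\<close> this is the norm of \<open>f\<close> from
      polynomials over \<open>K(s)\<close> to polynomials over \<open>K\<close>.\<close>
    define n where "n = g * g - smult (s\<^sup>2) (h * h)"
    have n: "poly_over K n"
      unfolding n_def using gh K d by (intro poly_over_diff poly_over_smult poly_over_mult)
    have pair: "map_poly (ext (c \<sigma>) \<sigma>) f * map_poly (ext (- c \<sigma>) \<sigma>) f = map_poly \<sigma> n"
      if "\<sigma> \<in> set \<Sigma>" for \<sigma>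
    proof -
      have \<sigma>: "field_hom_on K \<sigma>"
        using \<Sigma> that by (auto simp: complete_embeddings_def)
      have ext: "map_poly (ext e \<sigma>) f = map_poly \<sigma> g + smult e (map_poly \<sigma> h)" for e
        by (intro poly_eqI)
          (simp add: coeff_map_poly ext_def g_def h_def AB00 field_hom_on_0[OF K \<sigma>])
      have "map_poly \<sigma> n = map_poly \<sigma> g * map_poly \<sigma> g
          - smult (\<sigma> (s\<^sup>2)) (map_poly \<sigma> h * map_poly \<sigma> h)"
        unfolding n_def using gh d K
        by (simp add: map_poly_hom_on_diff[OF K \<sigma>] map_poly_hom_on_smult[OF K \<sigma>]
            map_poly_hom_on_mult[OF K \<sigma>] poly_over_mult poly_over_smult)
      moreover have "c \<sigma> * c \<sigma> = \<sigma> (s\<^sup>2)"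
        by (metis c2 power2_eq_square)
      ultimately have "map_poly \<sigma> n = (map_poly \<sigma> g + smult (c \<sigma>) (map_poly \<sigma> h)) * (map_poly \<sigma> g + smult (- c \<sigma>) (map_poly \<sigma> h))"
        by (simp add: algebra_simps)
      then show ?thesis by (simp add: ext)
    qed
    have "(\<Prod>\<tau>\<leftarrow>\<Sigma>'. map_poly \<tau> f) = (\<Prod>\<sigma>\<leftarrow>\<Sigma>. map_poly \<sigma> n)"
      unfolding \<Sigma>'_def prod_list_concat_pairs using pair by (simp cong: map_cong)
    then show "poly_over \<rat> (\<Prod>\<tau>\<leftarrow>\<Sigma>'. map_poly \<tau> f)"
      using \<Sigma> n by (simp add: complete_embeddings_def)
  qed
  then show ?thesis ..
qed

lemma quad_tower_complete_embeddings:
  assumes "quad_tower \<rat> K"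
  shows "\<exists>\<Sigma>. complete_embeddings K \<Sigma>"
  using assms
proof induction
  case base
  then show ?case using complete_embeddings_Rats by blast
next
  case (step K K')
  have K: "is_subfield K"
    using quad_tower_subfield[OF step(1) subfield_Rats] by simp
  obtain s where s: "s\<^sup>2 \<in> K" "K' = adjoin_root K s"
    using step by (auto simp: quad_step_def)
  show ?case
  proof (cases "s \<in> K")
    case True
    then show ?thesis using step.IH s K by (simp add: adjoin_root_absorb)
  next
    case False
    then show ?thesis using step.IH s K complete_embeddings_adjoin_root by blast
  qed
qed

lemma poly_prod_list_eq_0_iff:
  "poly (\<Prod>x\<leftarrow>xs. F x) z = 0 \<longleftrightarrow> (\<exists>x\<in>set xs. poly (F x) (z :: complex) = 0)"
  by (induction xs) auto

text \<open>Embeddings preserve rational polynomial equations, so they map \<open>y\<close> to roots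
  of any rational polynomial vanishing at \<open>y\<close>. Conversely the norm \<open>N\<close> of
  \<open>X - y\<close> is rational, and its roots are exactly the images of
  \<open>y\<close>.\<close>

lemma is_totally_real_iff_embeddings:
  assumes K: "is_subfield K" and \<Sigma>: "complete_embeddings K \<Sigma>" and y: "y \<in> K"
  shows "is_totally_real y \<longleftrightarrow> (\<forall>\<sigma>\<in>set \<Sigma>. \<sigma> y \<in> \<real>)"
proof
  assume "is_totally_real y"
  then obtain p where p: "poly (cpoly p) y = 0" "\<And>z. poly (cpoly p) z = 0 \<Longrightarrow> z \<in> \<real>"
    by (auto simp: is_totally_real_iff)
  show "\<forall>\<sigma>\<in>set \<Sigma>. \<sigma> y \<in> \<real>"
  proof
    fix \<sigma> assume "\<sigma> \<in> set \<Sigma>"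
    then have \<sigma>: "field_hom_on K \<sigma>"
      using \<Sigma> by (auto simp: complete_embeddings_def)
    have "poly (cpoly p) (\<sigma> y) = 0"
      using field_hom_on_poly[OF K \<sigma> y, of p] p(1) field_hom_on_0[OF K \<sigma>] by simp
    then show "\<sigma> y \<in> \<real>" by (rule p(2))
  qed
next
  assume real: "\<forall>\<sigma>\<in>set \<Sigma>. \<sigma> y \<in> \<real>"
  define N where "N = (\<Prod>\<sigma>\<leftarrow>\<Sigma>. map_poly \<sigma> [:- y, 1:])"
  have lin: "map_poly \<sigma> [:- y, 1:] = [:- \<sigma> y, 1:]" if "\<sigma> \<in> set \<Sigma>" for \<sigma>
  proof -
    have \<sigma>: "field_hom_on K \<sigma>"
      using \<Sigma> that by (auto simp: complete_embeddings_def)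
    show ?thesis
      using field_hom_on_0[OF K \<sigma>] field_hom_on_1[OF \<sigma>] field_hom_on_uminus[OF K \<sigma> y]
      by (simp add: map_poly_pCons)
  qed
  have roots: "poly N z = 0 \<longleftrightarrow> (\<exists>\<sigma>\<in>set \<Sigma>. z = \<sigma> y)" for z
    unfolding N_def poly_prod_list_eq_0_iff using lin by auto
  have "poly_over K [:- y, 1:]"
    using y K by (auto simp: poly_over_def coeff_pCons subfield_uminus subfield_1 subfield_0 split: nat.split)
  then have "poly_over \<rat> N"
    using \<Sigma> by (simp add: complete_embeddings_def N_def)
  then obtain p where p: "N = cpoly p"
    using ratpolyE unfolding poly_over_def by blast
  have "poly N y = 0"
    unfolding roots using \<Sigma> y by (metis complete_embeddings_def)
  moreover have "N \<noteq> 0"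
    using lin by (auto simp: N_def prod_list_zero_iff)
  ultimately show "is_totally_real y"
    unfolding is_totally_real_iff using roots real p by (intro exI[of _ p]) auto
qed

section \<open>Constructible numbers as a union of quadratic towers, and their totally real
  part\<close>

lemma F_sqrt_eq: "F_sqrt = \<Union>{K. quad_tower \<rat> K}"
proof
  let ?U = "\<Union>{K. quad_tower \<rat> K}"
  have sub: "is_subfield K" if "quad_tower \<rat> K" for K
    using quad_tower_subfield[OF that subfield_Rats] by simp
  have join: "\<exists>M. quad_tower \<rat> M \<and> x \<in> M \<and> y \<in> M" if xy: "x \<in> ?U" "y \<in> ?U" for x y
  proof -
    obtain K K' where "quad_tower \<rat> K" "x \<in> K" "quad_tower \<rat> K'" "y \<in> K'"
      using xy by blast
    then show ?thesis
      using quad_tower_directed[OF _ _ subfield_Rats subfield_Rats order_refl] by blast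
  qed
  \<comment> \<open>Any two elements lie in a common tower field, where the operations can be
    carried out.\<close>
  have "is_subfield ?U"
    unfolding is_subfield_def
  proof (intro conjI ballI impI)
    show "0 \<in> ?U" "1 \<in> ?U" by (auto intro: exI[of _ "\<rat>"])
    fix x assume x: "x \<in> ?U"
    then show "inverse x \<in> ?U" using sub subfield_inverse by blast
    fix y assume y: "y \<in> ?U"
    obtain M where "quad_tower \<rat> M" "x \<in> M" "y \<in> M"
      using join[OF x y] by blast
    then show "x + y \<in> ?U" "x - y \<in> ?U" "x * y \<in> ?U"
      using sub[of M] subfield_add[of M x y] subfield_diff[of M x y] subfield_mult[of M x y] by blast+
  qed
  moreover have "\<exists>y\<in>?U. y\<^sup>2 = x" if x: "x \<in> ?U" for x
  proof -
    obtain K where K: "quad_tower \<rat> K" "x \<in> K" using x by blast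
    then have "quad_step K (adjoin_root K (csqrt x))"
      unfolding quad_step_def by (metis power2_csqrt)
    then have "quad_tower \<rat> (adjoin_root K (csqrt x))"
      using K by (meson rtranclp.rtrancl_into_rtrancl)
    moreover have "csqrt x \<in> adjoin_root K (csqrt x)"
      using sub[OF K(1)] by (rule root_in_adjoin_root)
    ultimately show ?thesis
      by (metis (mono_tags) Union_iff mem_Collect_eq power2_csqrt)
  qed
  ultimately show "F_sqrt \<subseteq> ?U"
    unfolding F_sqrt_def by blast
  \<comment> \<open>Going up a tower, \<open>M\<close> contains some root of \<open>s^2\<close>; it
    agrees with \<open>s\<close> up to sign, so \<open>s\<close> lies in \<open>M\<close>
    too.\<close>
  have "K \<subseteq> M" if "quad_tower \<rat> K" "is_subfield M" and sqrt: "\<forall>x\<in>M. \<exists>y\<in>M. y\<^sup>2 = x" for K M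
    using that(1)
  proof induction
    case base
    then show ?case by (rule Rats_subset_subfield[OF that(2)])
  next
    case (step K K')
    obtain s where s: "s\<^sup>2 \<in> K" "K' = adjoin_root K s"
      using step by (auto simp: quad_step_def)
    obtain y where y: "y \<in> M" "y\<^sup>2 = s\<^sup>2"
      using sqrt s step by blast
    then have "s = y \<or> s = - y"
      by (metis power2_eq_iff)
    then have "s \<in> M"
      using y that(2) by (auto simp: subfield_uminus)
    then show ?case
      using s step adjoin_root_subset[OF that(2)] by blast
  qed
  then show "?U \<subseteq> F_sqrt"
    unfolding F_sqrt_def by blast
qed

lemma quad_tower_pair:
  assumes "x \<in> F_sqrt" "y \<in> F_sqrt"
  obtains M \<Sigma> where "quad_tower \<rat> M" "is_subfield M" "x \<in> M" "y \<in> M" "complete_embeddings M \<Sigma>"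
proof -
  obtain K K' where "quad_tower \<rat> K" "x \<in> K" "quad_tower \<rat> K'" "y \<in> K'"
    using assms unfolding F_sqrt_eq by blast
  then obtain M where "quad_tower \<rat> M" "x \<in> M" "y \<in> M"
    using quad_tower_directed[OF _ _ subfield_Rats subfield_Rats order_refl] by blast
  then show ?thesis
    using that quad_tower_subfield[OF _ subfield_Rats] quad_tower_complete_embeddings by blast
qed

text \<open>Two elements are placed in one tower field, where being totally real means having real
  images and passes through the field operations. For the square root \<open>y\<close> the tower
  gets one more step; every image of \<open>y\<close> squares to \<open>1 + r^2\<close> with
  \<open>r\<close> real, hence is real.\<close>

lemma pythagorean_F_sqrt_Int_F_TR: "pythagorean (F_sqrt \<inter> F_TR)"
proof -
  have closed: "x + y \<in> F_sqrt \<inter> F_TR \<and> x - y \<in> F_sqrt \<inter> F_TR \<and> x * y \<in> F_sqrt \<inter> F_TR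
      \<and> inverse x \<in> F_sqrt \<inter> F_TR"
    if xy: "x \<in> F_sqrt \<inter> F_TR" "y \<in> F_sqrt \<inter> F_TR" for x y
  proof -
    obtain M \<Sigma> where M: "quad_tower \<rat> M" and sf: "is_subfield M" and in_M: "x \<in> M" "y \<in> M"
      and \<Sigma>: "complete_embeddings M \<Sigma>"
      using quad_tower_pair[of x y] xy by blast
    have MF: "M \<subseteq> F_sqrt" using M by (auto simp: F_sqrt_eq)
    have TR: "z \<in> F_sqrt \<inter> F_TR \<longleftrightarrow> (\<forall>\<sigma>\<in>set \<Sigma>. \<sigma> z \<in> \<real>)" if "z \<in> M" for z
      using is_totally_real_iff_embeddings[OF sf \<Sigma> that] MF that by (auto simp: F_TR_def)
    have hom: "field_hom_on M \<sigma>" if "\<sigma> \<in> set \<Sigma>" for \<sigma>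
      using \<Sigma> that by (simp add: complete_embeddings_def)
    have real: "\<sigma> x \<in> \<real>" "\<sigma> y \<in> \<real>" if "\<sigma> \<in> set \<Sigma>" for \<sigma>
      using xy TR[OF in_M(1)] TR[OF in_M(2)] that by auto
    show ?thesis
      using in_M real hom sf
      by (auto simp: TR subfield_add subfield_diff subfield_mult subfield_inverse
          field_hom_on_add[of M] field_hom_on_mult[of M] field_hom_on_diff[of M]
          field_hom_on_inverse[of M]
          simp del: Int_iff)
  qed
  have Rats: "of_rat q \<in> F_sqrt \<inter> F_TR" for q
  proof -
    have "of_rat q \<in> F_sqrt"
      unfolding F_sqrt_eq by (auto intro!: exI[of _ "\<rat>"])
    moreover have "is_totally_real (of_rat q)"
      using is_totally_real_iff_embeddings[OF subfield_Rats complete_embeddings_Rats, of "of_rat q"]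
      by (simp add: of_rat_in_Reals)
    ultimately show ?thesis by (simp add: F_TR_def)
  qed
  have sf: "is_subfield (F_sqrt \<inter> F_TR)"
    unfolding is_subfield_def using closed Rats[of 0] Rats[of 1] by auto
  moreover have "\<exists>y\<in>F_sqrt \<inter> F_TR. y\<^sup>2 = 1 + x\<^sup>2" if x: "x \<in> F_sqrt \<inter> F_TR" for x
  proof -
    obtain K where K: "quad_tower \<rat> K" "x \<in> K"
      using x by (auto simp: F_sqrt_eq)
    have K': "is_subfield K"
      using quad_tower_subfield[OF K(1) subfield_Rats] by simp
    define y where "y = csqrt (1 + x\<^sup>2)"
    define M where "M = adjoin_root K y"
    have y2: "y\<^sup>2 = 1 + x\<^sup>2" by (simp add: y_def)
    have "y\<^sup>2 \<in> K"
      unfolding y2 using K K' by (intro subfield_add subfield_1 subfield_power)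
    then have step: "quad_step K M"
      by (auto simp: M_def quad_step_def)
    then have M: "quad_tower \<rat> M" "is_subfield M" "x \<in> M" "y \<in> M"
      using K K' quad_tower_subfield[of K M] root_in_adjoin_root[OF K', of y]
      by (auto simp: M_def)
    obtain \<Sigma> where \<Sigma>: "complete_embeddings M \<Sigma>"
      using quad_tower_complete_embeddings[OF M(1)] by blast
    have "\<sigma> y \<in> \<real>" if "\<sigma> \<in> set \<Sigma>" for \<sigma>
    proof -
      have \<sigma>: "field_hom_on M \<sigma>"
        using \<Sigma> that by (simp add: complete_embeddings_def)
      have "\<sigma> x \<in> \<real>"
        using is_totally_real_iff_embeddings[OF M(2) \<Sigma> M(3)] x that by (simp add: F_TR_def)
      then obtain r where r: "\<sigma> x = complex_of_real r"
        by (meson Reals_cases)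
      have "(\<sigma> y)\<^sup>2 = \<sigma> (1 + x * x)"
        using field_hom_on_mult[OF \<sigma> M(4) M(4)] y2 by (simp add: power2_eq_square)
      also have "\<dots> = of_real (1 + r\<^sup>2)"
        using M by (simp add: field_hom_on_add[OF \<sigma>] field_hom_on_mult[OF \<sigma>] field_hom_on_1[OF \<sigma>]
            subfield_1 subfield_mult r power2_eq_square)
      also have "\<dots> = (complex_of_real (sqrt (1 + r\<^sup>2)))\<^sup>2"
        by (simp flip: of_real_power)
      finally have "\<sigma> y = complex_of_real (sqrt (1 + r\<^sup>2)) \<or> \<sigma> y = - complex_of_real (sqrt (1 + r\<^sup>2))"
        by (metis power2_eq_iff)
      then show ?thesis by auto
    qed
    then have "is_totally_real y"
      using is_totally_real_iff_embeddings[OF M(2) \<Sigma> M(4)] by blast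
    moreover have "y \<in> F_sqrt"
      using M by (auto simp: F_sqrt_eq)
    ultimately show ?thesis
      using y2 by (auto simp: F_TR_def)
  qed
  ultimately show ?thesis by (simp add: pythagorean_def)
qed

section \<open>The smallest Pythagorean field\<close>

lemma pythagorean_Inter:
  assumes "\<And>K. K \<in> \<K> \<Longrightarrow> pythagorean K"
  shows "pythagorean (\<Inter>\<K>)"
  unfolding pythagorean_def
proof
  show "is_subfield (\<Inter>\<K>)"
    unfolding is_subfield_def
    using assms by (auto simp: pythagorean_def intro: subfield_intros)
  show "\<forall>x\<in>\<Inter>\<K>. \<exists>y\<in>\<Inter>\<K>. y\<^sup>2 = 1 + x\<^sup>2"
  proof (intro ballI bexI)
    fix x assume x: "x \<in> \<Inter>\<K>"
    show "(csqrt (1 + x\<^sup>2))\<^sup>2 = 1 + x\<^sup>2" by simp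
    show "csqrt (1 + x\<^sup>2) \<in> \<Inter>\<K>"
    proof
      fix K assume "K \<in> \<K>"
      then have K: "pythagorean K" "x \<in> K" using assms x by auto
      \<comment> \<open>Whichever root \<open>K\<close> provides, closure under negation puts the
        principal one into \<open>K\<close> as well, so a single root serves all members of the
        family.\<close>
      then obtain y where y: "y \<in> K" "y\<^sup>2 = (csqrt (1 + x\<^sup>2))\<^sup>2"
        by (auto simp: pythagorean_def)
      then have "csqrt (1 + x\<^sup>2) = y \<or> csqrt (1 + x\<^sup>2) = - y"
        by (metis power2_eq_iff)
      then show "csqrt (1 + x\<^sup>2) \<in> K"
        using y K by (auto simp: pythagorean_def subfield_uminus)
    qed
  qed
qed

lemma F_sqrt_1_plus_sq_eq: "F_sqrt_1_plus_sq = \<Inter>{K. pythagorean K}"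
  by (simp add: F_sqrt_1_plus_sq_def pythagorean_def)

lemma pythagorean_F_sqrt_1_plus_sq: "pythagorean F_sqrt_1_plus_sq"
  unfolding F_sqrt_1_plus_sq_eq by (rule pythagorean_Inter) simp

theorem F_sqrt_1_plus_sq_eq_Int: "F_sqrt_1_plus_sq = F_sqrt \<inter> F_TR"
proof
  show "F_sqrt_1_plus_sq \<subseteq> F_sqrt \<inter> F_TR"
    using pythagorean_F_sqrt_Int_F_TR by (auto simp: F_sqrt_1_plus_sq_eq)
  then have sub: "F_sqrt_1_plus_sq \<subseteq> F_sqrt \<inter> F_TR" .
  have F: "is_subfield F_sqrt_1_plus_sq" and T: "is_subfield (F_sqrt \<inter> F_TR)"
    using pythagorean_F_sqrt_1_plus_sq pythagorean_F_sqrt_Int_F_TR by (auto simp: pythagorean_def)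
  show "F_sqrt \<inter> F_TR \<subseteq> F_sqrt_1_plus_sq"
  proof (rule subsetI, rule ccontr)
    fix x assume x: "x \<in> F_sqrt \<inter> F_TR" and nx: "x \<notin> F_sqrt_1_plus_sq"
    obtain K where K: "quad_tower \<rat> K" "x \<in> K"
      using x by (auto simp: F_sqrt_eq)
    \<comment> \<open>The tower over the rationals containing \<open>x\<close> is repeated over
      \<open>F_sqrt_1_plus_sq\<close>, starting from the trivial tower there.\<close>
    obtain M where M: "quad_tower F_sqrt_1_plus_sq M" "K \<subseteq> M"
      using quad_tower_directed[OF rtranclp.rtrancl_refl K(1) F subfield_Rats Rats_subset_subfield[OF F]]
      by blast
    obtain t where t: "t \<in> F_sqrt \<inter> F_TR" "t \<notin> F_sqrt_1_plus_sq" "t\<^sup>2 \<in> F_sqrt_1_plus_sq"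
      using quad_tower_intermediate[OF M(1) F T sub x _ nx] M(2) K(2) by blast
    then show False
      using pythagorean_sqrt_totally_real[OF pythagorean_F_sqrt_1_plus_sq, of t]
      by (auto simp: F_TR_def)
  qed
qed

section \<open>Lines in coordinates\<close>

text \<open>Lines by equations; this is a line exactly when the normal vector
  \<open>(\<alpha>, \<beta>)\<close> is nonzero, and proportional coefficients give the same
  set.\<close>

definition aline :: "real \<Rightarrow> real \<Rightarrow> real \<Rightarrow> complex set" where
  "aline \<alpha> \<beta> \<gamma> = {z. \<alpha> * Re z + \<beta> * Im z + \<gamma> = 0}"

lemma aline_iff: "z \<in> aline \<alpha> \<beta> \<gamma> \<longleftrightarrow> \<alpha> * Re z + \<beta> * Im z + \<gamma> = 0"
  by (simp add: aline_def)

lemma sum_squares_pos: "(\<alpha>, \<beta>) \<noteq> (0, 0) \<Longrightarrow> \<alpha>\<^sup>2 + \<beta>\<^sup>2 > (0 :: real)"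
  by (auto simp: sum_power2_gt_zero_iff)

lemma line_through_eq_aline:
  assumes "a \<noteq> b" "a \<in> aline \<alpha> \<beta> \<gamma>" "b \<in> aline \<alpha> \<beta> \<gamma>" "(\<alpha>, \<beta>) \<noteq> (0, 0)"
  shows "line_through a b = aline \<alpha> \<beta> \<gamma>"
proof
  show "line_through a b \<subseteq> aline \<alpha> \<beta> \<gamma>"
  proof
    fix z assume "z \<in> line_through a b"
    then obtain t where t: "z = a + of_real t * (b - a)" by (auto simp: line_through_def)
    have "\<alpha> * Re z + \<beta> * Im z + \<gamma>
      = (1 - t) * (\<alpha> * Re a + \<beta> * Im a + \<gamma>) + t * (\<alpha> * Re b + \<beta> * Im b + \<gamma>)"
      by (simp add: t algebra_simps)
    then show "z \<in> aline \<alpha> \<beta> \<gamma>" using assms by (simp add: aline_iff)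
  qed
  show "aline \<alpha> \<beta> \<gamma> \<subseteq> line_through a b"
  proof
    fix z assume z: "z \<in> aline \<alpha> \<beta> \<gamma>"
    define x y where "x = Re (b - a)" and "y = Im (b - a)"
    define u v where "u = Re (z - a)" and "v = Im (z - a)"
    have ab: "\<alpha> * x + \<beta> * y = 0" and uv: "\<alpha> * u + \<beta> * v = 0"
      using assms(2,3) z by (simp_all add: aline_iff x_def y_def u_def v_def algebra_simps)
    \<comment> \<open>Both difference vectors are orthogonal to the nonzero normal, so their
      determinant vanishes.\<close>
    have det: "u * y = v * x"
    proof -
      have "\<alpha> * (u * y - v * x) = y * (\<alpha> * u + \<beta> * v) - v * (\<alpha> * x + \<beta> * y)"
        "\<beta> * (u * y - v * x) = u * (\<alpha> * x + \<beta> * y) - x * (\<alpha> * u + \<beta> * v)"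
        by (simp_all add: algebra_simps)
      then show ?thesis using ab uv assms(4) by auto
    qed
    have "(x, y) \<noteq> (0, 0)"
      using assms(1) by (auto simp: x_def y_def complex_eq_iff)
    then have m: "x\<^sup>2 + y\<^sup>2 > 0" by (rule sum_squares_pos)
    define M where "M = x\<^sup>2 + y\<^sup>2"
    define N where "N = u * x + v * y"
    \<comment> \<open>The coefficient of the orthogonal projection of \<open>z - a\<close> onto
      \<open>b - a\<close>.\<close>
    define t where "t = N / M"
    have "u * M = N * x + y * (u * y - v * x)" "v * M = N * y - x * (u * y - v * x)"
      by (simp_all add: M_def N_def algebra_simps power2_eq_square)
    moreover have "M > 0"
      using m by (simp add: M_def)
    ultimately have "u = t * x" "v = t * y"
      unfolding t_def using det by (simp_all add: eq_divide_eq)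
    then have "z = a + of_real t * (b - a)"
      by (simp add: complex_eq_iff u_def v_def x_def y_def algebra_simps)
    then show "z \<in> line_through a b" by (auto simp: line_through_def)
  qed
qed

lemma line_through_aline:
  assumes "a \<noteq> b"
  shows "line_through a b = aline (- Im (b - a)) (Re (b - a)) (Im (b - a) * Re a - Re (b - a) * Im a)"
  using assms by (intro line_through_eq_aline) (auto simp: aline_iff complex_eq_iff algebra_simps)

text \<open>The first point is the foot of the perpendicular from the origin; the second is
  displaced by a direction vector of the line.\<close>

lemma aline_points:
  assumes "(\<alpha>, \<beta>) \<noteq> (0, 0)"
  obtains a where "a \<in> aline \<alpha> \<beta> \<gamma>" "a + Complex (- \<beta>) \<alpha> \<in> aline \<alpha> \<beta> \<gamma>" "a + Complex (- \<beta>) \<alpha> \<noteq> a"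
proof (rule that)
  define c where "c = - \<gamma> / (\<alpha>\<^sup>2 + \<beta>\<^sup>2)"
  let ?a = "Complex (c * \<alpha>) (c * \<beta>)"
  have "\<alpha>\<^sup>2 + \<beta>\<^sup>2 \<noteq> 0"
    using sum_squares_pos[OF assms] by (rule less_imp_neq[symmetric])
  then have "c * (\<alpha>\<^sup>2 + \<beta>\<^sup>2) = - \<gamma>"
    unfolding c_def by (metis nonzero_eq_divide_eq)
  then show "?a \<in> aline \<alpha> \<beta> \<gamma>"
    by (simp add: aline_iff algebra_simps power2_eq_square)
  then show "?a + Complex (- \<beta>) \<alpha> \<in> aline \<alpha> \<beta> \<gamma>"
    by (simp add: aline_iff algebra_simps)
  show "?a + Complex (- \<beta>) \<alpha> \<noteq> ?a"
    using assms by (auto simp: complex_eq_iff)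
qed

lemma is_line_aline:
  assumes "(\<alpha>, \<beta>) \<noteq> (0, 0)"
  shows "is_line (aline \<alpha> \<beta> \<gamma>)"
  using aline_points[OF assms, of \<gamma>] line_through_eq_aline[OF _ _ _ assms]
  unfolding is_line_def by metis

lemma aline_eqI:
  assumes "z \<in> aline \<alpha> \<beta> \<gamma>" "z \<in> aline \<alpha>' \<beta>' \<gamma>'" "\<alpha> * \<beta>' = \<alpha>' * \<beta>"
    and nz: "(\<alpha>, \<beta>) \<noteq> (0, 0)" "(\<alpha>', \<beta>') \<noteq> (0, 0)"
  shows "aline \<alpha> \<beta> \<gamma> = aline \<alpha>' \<beta>' \<gamma>'"
proof -
  let ?w = "z + Complex (- \<beta>) \<alpha>"
  have "?w \<noteq> z" using nz by (auto simp: complex_eq_iff)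
  moreover have "?w \<in> aline \<alpha> \<beta> \<gamma>" "?w \<in> aline \<alpha>' \<beta>' \<gamma>'"
    using assms(1-3) by (auto simp: aline_iff algebra_simps)
  ultimately show ?thesis
    using line_through_eq_aline[of z ?w] assms by metis
qed

text \<open>Parallel lines with a common point coincide. The common point is available wherever the
  intersection axiom is used.\<close>

lemma parallel_alines_iff:
  assumes nz: "(\<alpha>, \<beta>) \<noteq> (0, 0)" "(\<alpha>', \<beta>') \<noteq> (0, 0)"
    and z: "z \<in> aline \<alpha> \<beta> \<gamma>" "z \<in> aline \<alpha>' \<beta>' \<gamma>'"
  shows "parallel_lines (aline \<alpha> \<beta> \<gamma>) (aline \<alpha>' \<beta>' \<gamma>') \<longleftrightarrow> \<alpha> * \<beta>' = \<alpha>' * \<beta>"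
proof
  assume "parallel_lines (aline \<alpha> \<beta> \<gamma>) (aline \<alpha>' \<beta>' \<gamma>')"
  then obtain c where c: "aline \<alpha>' \<beta>' \<gamma>' = (\<lambda>z. z + c) ` aline \<alpha> \<beta> \<gamma>"
    by (auto simp: parallel_lines_def)
  obtain a where "a \<in> aline \<alpha> \<beta> \<gamma>" "a + Complex (- \<beta>) \<alpha> \<in> aline \<alpha> \<beta> \<gamma>"
    using aline_points[OF nz(1), of \<gamma>] .
  then have "a + c \<in> aline \<alpha>' \<beta>' \<gamma>'" "a + Complex (- \<beta>) \<alpha> + c \<in> aline \<alpha>' \<beta>' \<gamma>'"
    using c by auto
  then show "\<alpha> * \<beta>' = \<alpha>' * \<beta>"
    by (simp add: aline_iff algebra_simps)
next
  assume "\<alpha> * \<beta>' = \<alpha>' * \<beta>"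
  then have "aline \<alpha> \<beta> \<gamma> = aline \<alpha>' \<beta>' \<gamma>'"
    using aline_eqI[OF z _ nz] by simp
  then show "parallel_lines (aline \<alpha> \<beta> \<gamma>) (aline \<alpha>' \<beta>' \<gamma>')"
    unfolding parallel_lines_def by (intro exI[of _ 0]) simp
qed

lemma perp_bisector_eq_aline:
  "perp_bisector a b = aline (2 * (Re b - Re a)) (2 * (Im b - Im a))
     ((Re a)\<^sup>2 + (Im a)\<^sup>2 - (Re b)\<^sup>2 - (Im b)\<^sup>2)"
proof -
  have "dist z a = dist z b \<longleftrightarrow> z \<in> aline (2 * (Re b - Re a)) (2 * (Im b - Im a))
     ((Re a)\<^sup>2 + (Im a)\<^sup>2 - (Re b)\<^sup>2 - (Im b)\<^sup>2)" for z
  proof -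
    have sq: "(dist z c)\<^sup>2 = (Re z - Re c)\<^sup>2 + (Im z - Im c)\<^sup>2" for c
      by (simp add: dist_norm cmod_power2)
    have "dist z a = dist z b \<longleftrightarrow> (dist z a)\<^sup>2 = (dist z b)\<^sup>2"
      by (simp add: power2_eq_iff_nonneg)
    then show ?thesis
      unfolding sq by (simp add: aline_iff power2_eq_square algebra_simps)
  qed
  then show ?thesis by (auto simp: perp_bisector_def)
qed

lemma infdist_aline:
  assumes nz: "(\<alpha>, \<beta>) \<noteq> (0, 0)"
  shows "infdist z (aline \<alpha> \<beta> \<gamma>) = \<bar>\<alpha> * Re z + \<beta> * Im z + \<gamma>\<bar> / sqrt (\<alpha>\<^sup>2 + \<beta>\<^sup>2)"
proof (rule antisym)
  define m where "m = \<alpha>\<^sup>2 + \<beta>\<^sup>2"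
  have m: "m > 0" using sum_squares_pos[OF nz] by (simp add: m_def)
  define f where "f = \<alpha> * Re z + \<beta> * Im z + \<gamma>"
  define c where "c = f / m"
  \<comment> \<open>The foot of the perpendicular from \<open>z\<close>, which attains the
    distance.\<close>
  define w where "w = z - of_real c * Complex \<alpha> \<beta>"
  have "\<alpha> * Re w + \<beta> * Im w + \<gamma> = f - c * m"
    by (simp add: w_def f_def m_def algebra_simps power2_eq_square)
  then have "w \<in> aline \<alpha> \<beta> \<gamma>"
    using m by (simp add: aline_iff c_def)
  then have "infdist z (aline \<alpha> \<beta> \<gamma>) \<le> dist z w" by (rule infdist_le)
  also have "\<dots> = cmod (of_real c * Complex \<alpha> \<beta>)"
    by (simp only: w_def dist_norm) simp
  also have "\<dots> = \<bar>c\<bar> * sqrt m"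
    by (simp only: norm_mult norm_of_real) (simp add: cmod_def m_def)
  also have "\<dots> = \<bar>f\<bar> / m * sqrt m"
    using m by (simp add: c_def)
  also have "\<dots> = \<bar>f\<bar> / sqrt m"
    using m by (simp add: field_simps)
  finally show "infdist z (aline \<alpha> \<beta> \<gamma>) \<le> \<bar>\<alpha> * Re z + \<beta> * Im z + \<gamma>\<bar> / sqrt (\<alpha>\<^sup>2 + \<beta>\<^sup>2)"
    by (simp add: f_def m_def)
  have "\<bar>f\<bar> / sqrt m \<le> dist z v" if v: "v \<in> aline \<alpha> \<beta> \<gamma>" for v
  proof -
    have "f = \<alpha> * Re (z - v) + \<beta> * Im (z - v)"
      using v by (simp add: f_def aline_iff algebra_simps)
    \<comment> \<open>Lagrange's identity; dropping the second square leaves the Cauchy-Schwarz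
      inequality.\<close>
    then have "f\<^sup>2 + (\<alpha> * Im (z - v) - \<beta> * Re (z - v))\<^sup>2 = m * (cmod (z - v))\<^sup>2"
      by (simp only: m_def cmod_power2) (simp add: algebra_simps power2_eq_square)
    then have "f\<^sup>2 \<le> (sqrt m * cmod (z - v))\<^sup>2"
      using m by (simp add: power_mult_distrib) (metis le_add_same_cancel1 zero_le_power2)
    then have "\<bar>f\<bar> \<le> sqrt m * cmod (z - v)"
      using m by (metis abs_le_square_iff abs_of_nonneg norm_ge_zero real_sqrt_ge_zero
          less_imp_le mult_nonneg_nonneg)
    then show ?thesis
      using m by (simp add: dist_norm field_simps)
  qed
  moreover have "aline \<alpha> \<beta> \<gamma> \<noteq> {}"
    using \<open>w \<in> _\<close> by auto
  ultimately show "\<bar>\<alpha> * Re z + \<beta> * Im z + \<gamma>\<bar> / sqrt (\<alpha>\<^sup>2 + \<beta>\<^sup>2) \<le> infdist z (aline \<alpha> \<beta> \<gamma>)"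
    unfolding infdist_notempty[OF \<open>aline \<alpha> \<beta> \<gamma> \<noteq> {}\<close>] f_def[symmetric] m_def[symmetric]
    by (intro cINF_greatest) auto
qed

text \<open>The direction \<open>b - a\<close> is a real multiple of \<open>\<i> * \<nu>\<close>
  with \<open>\<nu>\<close> the normal, and the multiple cancels. So the reflection depends on the
  line alone and not on the two chosen points.\<close>

lemma reflect_across_eq:
  assumes ab: "a \<noteq> b" "a \<in> aline \<alpha> \<beta> \<gamma>" "b \<in> aline \<alpha> \<beta> \<gamma>" and nz: "(\<alpha>, \<beta>) \<noteq> (0, 0)"
  shows "reflect_across a b z
    = z - of_real (2 * (\<alpha> * Re z + \<beta> * Im z + \<gamma>) / (\<alpha>\<^sup>2 + \<beta>\<^sup>2)) * Complex \<alpha> \<beta>"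
proof -
  define \<nu> where "\<nu> = Complex \<alpha> \<beta>"
  define m where "m = \<alpha>\<^sup>2 + \<beta>\<^sup>2"
  have m: "m > 0" using sum_squares_pos[OF nz] by (simp add: m_def)
  have \<nu>: "\<nu> * cnj \<nu> = of_real m" "\<nu> \<noteq> 0"
    using nz by (auto simp: \<nu>_def m_def complex_eq_iff power2_eq_square)
  define x y where "x = Re (b - a)" and "y = Im (b - a)"
  define t where "t = (\<alpha> * y - \<beta> * x) / m"
  have orth: "\<alpha> * x + \<beta> * y = 0"
    using ab by (simp add: aline_iff x_def y_def algebra_simps)
  have "x * m = - \<beta> * (\<alpha> * y - \<beta> * x) + \<alpha> * (\<alpha> * x + \<beta> * y)"
    "y * m = \<alpha> * (\<alpha> * y - \<beta> * x) + \<beta> * (\<alpha> * x + \<beta> * y)"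
    by (simp_all add: m_def algebra_simps power2_eq_square)
  then have "x = - \<beta> * t" "y = \<alpha> * t"
    using orth m by (simp_all add: t_def field_simps)
  then have d: "b - a = of_real t * \<i> * \<nu>"
    by (simp add: complex_eq_iff \<nu>_def x_def y_def)
  have t0: "t \<noteq> 0" using d ab(1) by auto
  define u where "u = z - a"
  have fz: "\<alpha> * Re z + \<beta> * Im z + \<gamma> = Re (u * cnj \<nu>)"
    using ab(2) by (simp add: aline_iff u_def \<nu>_def algebra_simps)
  have "of_real (2 * Re (u * cnj \<nu>)) = u * cnj \<nu> + cnj u * \<nu>"
    by (simp add: complex_eq_iff)
  then have "of_real (2 * (\<alpha> * Re z + \<beta> * Im z + \<gamma>) / m) * \<nu> = (u * cnj \<nu> + cnj u * \<nu>) / (\<nu> * cnj \<nu>) * \<nu>"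
    unfolding fz \<nu>(1) by (simp del: of_real_mult)
  also have "\<dots> = u + cnj u * \<nu> / cnj \<nu>"
    using \<nu>(2) by (simp add: field_simps)
  finally have 1: "z - of_real (2 * (\<alpha> * Re z + \<beta> * Im z + \<gamma>) / m) * \<nu> = a - cnj u * \<nu> / cnj \<nu>"
    by (simp add: u_def)
  have "reflect_across a b z = a + of_real t * \<i> * \<nu> * (cnj u / (of_real t * (- \<i>) * cnj \<nu>))"
    by (simp add: reflect_across_def d u_def)
  also have "\<dots> = a - cnj u * \<nu> / cnj \<nu>"
    using t0 \<nu>(2) by (simp add: field_simps)
  finally show ?thesis
    using 1 by (simp add: \<nu>_def m_def)
qed

lemma reflect_across_involution: "a \<noteq> b \<Longrightarrow> reflect_across a b (reflect_across a b z) = z"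
  by (simp add: reflect_across_def)

text \<open>A reflection is an involution, so the image of a line is its preimage, and its equation
  arises by substitution. The factor \<open>k\<close> is the one that reflects the normal
  vector.\<close>

lemma reflect_across_aline:
  fixes \<alpha>' \<beta>' \<gamma>' :: real
  assumes ab: "a \<noteq> b" "a \<in> aline \<alpha> \<beta> \<gamma>" "b \<in> aline \<alpha> \<beta> \<gamma>" and nz: "(\<alpha>, \<beta>) \<noteq> (0, 0)"
  defines "k \<equiv> 2 * (\<alpha> * \<alpha>' + \<beta> * \<beta>') / (\<alpha>\<^sup>2 + \<beta>\<^sup>2)"
  shows "reflect_across a b ` aline \<alpha>' \<beta>' \<gamma>' = aline (\<alpha>' - k * \<alpha>) (\<beta>' - k * \<beta>) (\<gamma>' - k * \<gamma>)"
proof -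
  have "z \<in> aline (\<alpha>' - k * \<alpha>) (\<beta>' - k * \<beta>) (\<gamma>' - k * \<gamma>) \<longleftrightarrow> reflect_across a b z \<in> aline \<alpha>' \<beta>' \<gamma>'" for z
  proof -
    define g where "g = (\<alpha> * Re z + \<beta> * Im z + \<gamma>) / (\<alpha>\<^sup>2 + \<beta>\<^sup>2)"
    have refl: "reflect_across a b z = z - of_real (2 * g) * Complex \<alpha> \<beta>"
      using reflect_across_eq[OF ab nz] by (simp add: g_def)
    have "\<alpha>' * Re (reflect_across a b z) + \<beta>' * Im (reflect_across a b z) + \<gamma>'
      = \<alpha>' * Re z + \<beta>' * Im z + \<gamma>' - 2 * g * (\<alpha> * \<alpha>' + \<beta> * \<beta>')"
      unfolding refl by (simp add: algebra_simps)
    also have "2 * g * (\<alpha> * \<alpha>' + \<beta> * \<beta>') = k * (\<alpha> * Re z + \<beta> * Im z + \<gamma>)"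
      by (simp add: g_def k_def algebra_simps)
    finally have eq: "\<alpha>' * Re (reflect_across a b z) + \<beta>' * Im (reflect_across a b z) + \<gamma>'
      = \<alpha>' * Re z + \<beta>' * Im z + \<gamma>' - k * (\<alpha> * Re z + \<beta> * Im z + \<gamma>)" .
    show ?thesis
      unfolding aline_iff eq by (simp add: algebra_simps)
  qed
  then have "aline (\<alpha>' - k * \<alpha>) (\<beta>' - k * \<beta>) (\<gamma>' - k * \<gamma>)
      = {z. reflect_across a b z \<in> aline \<alpha>' \<beta>' \<gamma>'}"
    by blast
  moreover have "reflect_across a b ` S = {z. reflect_across a b z \<in> S}" for S
  proof (intro set_eqI iffI)
    fix z assume "z \<in> {z. reflect_across a b z \<in> S}"
    then show "z \<in> reflect_across a b ` S"
      using reflect_across_involution[OF ab(1), of z] by (intro image_eqI[of z]) auto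
  qed (auto simp: reflect_across_involution[OF ab(1)])
  ultimately show ?thesis by simp
qed

section \<open>Origami pairs\<close>

text \<open>Comparing squares at 0, 1 and -1 gives equal squares of the coefficients and equal mixed
  products; the latter make one sign serve both coefficients.\<close>

lemma abs_eq_affine_cases:
  fixes p1 q1 p2 q2 :: real
  assumes "\<And>t. \<bar>p1 + t * q1\<bar> = \<bar>p2 + t * q2\<bar>"
  obtains \<epsilon> where "\<epsilon> = 1 \<or> \<epsilon> = - 1" "p1 = \<epsilon> * p2" "q1 = \<epsilon> * q2"
proof -
  have sq: "(p1 + t * q1)\<^sup>2 = (p2 + t * q2)\<^sup>2" for t
    using assms[of t] by (metis power2_abs)
  have p: "p1\<^sup>2 = p2\<^sup>2" and s1: "(p1 + q1)\<^sup>2 = (p2 + q2)\<^sup>2" and s2: "(p1 - q1)\<^sup>2 = (p2 - q2)\<^sup>2"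
    using sq[of 0] sq[of 1] sq[of "-1"] by simp_all
  have "p1 * q1 = p2 * q2" "q1\<^sup>2 = q2\<^sup>2"
    using p s1 s2 unfolding power2_eq_square by (simp_all add: algebra_simps)
  moreover have "p1 = p2 \<or> p1 = - p2" "q1 = q2 \<or> q1 = - q2"
    using p \<open>q1\<^sup>2 = q2\<^sup>2\<close> by (auto simp: power2_eq_iff)
  ultimately show ?thesis
    using that[of 1] that[of "- 1"] by (cases "p2 = 0") auto
qed

section \<open>The plane over a Pythagorean field of real numbers\<close>

locale pythagorean_reals =
  fixes R :: "real set"
  assumes pythagorean: "pythagorean (complex_of_real ` R)"
begin

lemma subfield: "is_subfield (complex_of_real ` R)"
  using pythagorean by (simp add: pythagorean_def)

lemma of_real_in_iff: "complex_of_real x \<in> complex_of_real ` R \<longleftrightarrow> x \<in> R"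
  by auto

lemma zero: "0 \<in> R" and one: "1 \<in> R"
  and add: "x \<in> R \<Longrightarrow> y \<in> R \<Longrightarrow> x + y \<in> R"
  and diff: "x \<in> R \<Longrightarrow> y \<in> R \<Longrightarrow> x - y \<in> R"
  and mult: "x \<in> R \<Longrightarrow> y \<in> R \<Longrightarrow> x * y \<in> R"
  and divide: "x \<in> R \<Longrightarrow> y \<in> R \<Longrightarrow> x / y \<in> R"
  and uminus: "x \<in> R \<Longrightarrow> - x \<in> R"
  unfolding of_real_in_iff[symmetric]
  using subfield subfield_0 subfield_1
  by (simp_all add: subfield_add subfield_diff subfield_mult subfield_divide subfield_uminus)

lemma two: "2 \<in> R"
  using add[OF one one] by simp

lemma power2: "x \<in> R \<Longrightarrow> x\<^sup>2 \<in> R"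
  by (simp add: power2_eq_square mult)

lemmas closed = zero one two add diff mult divide uminus power2

lemma abs_in_iff: "\<bar>x\<bar> \<in> R \<longleftrightarrow> x \<in> R"
  using uminus[of x] uminus[of "- x"] by (auto simp: abs_if)

lemma sqrt_add_squares:
  assumes "x \<in> R" "y \<in> R"
  shows "sqrt (x\<^sup>2 + y\<^sup>2) \<in> R"
proof -
  obtain z where z: "z \<in> R" "(complex_of_real z)\<^sup>2 = (of_real x)\<^sup>2 + (of_real y)\<^sup>2"
    using pythagorean_add_squares[OF pythagorean, of "of_real x" "of_real y"] assms by auto
  then have "complex_of_real (z\<^sup>2) = of_real (x\<^sup>2 + y\<^sup>2)" by simp
  then have "z\<^sup>2 = x\<^sup>2 + y\<^sup>2" by (simp only: of_real_eq_iff)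
  then have "\<bar>z\<bar> = sqrt (x\<^sup>2 + y\<^sup>2)" by (metis real_sqrt_abs)
  then show ?thesis using z abs_in_iff by metis
qed

definition plane :: "complex set" where
  "plane = {z. Re z \<in> R \<and> Im z \<in> R}"

definition plane_lines :: "complex set set" where
  "plane_lines = {aline \<alpha> \<beta> \<gamma> | \<alpha> \<beta> \<gamma>. \<alpha> \<in> R \<and> \<beta> \<in> R \<and> \<gamma> \<in> R \<and> (\<alpha>, \<beta>) \<noteq> (0, 0)}"

lemma plane_linesI:
  "\<alpha> \<in> R \<Longrightarrow> \<beta> \<in> R \<Longrightarrow> \<gamma> \<in> R \<Longrightarrow> (\<alpha>, \<beta>) \<noteq> (0, 0) \<Longrightarrow> aline \<alpha> \<beta> \<gamma> \<in> plane_lines"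
  by (auto simp: plane_lines_def)

lemma plane_linesE:
  assumes "L \<in> plane_lines"
  obtains \<alpha> \<beta> \<gamma> where "L = aline \<alpha> \<beta> \<gamma>" "\<alpha> \<in> R" "\<beta> \<in> R" "\<gamma> \<in> R" "(\<alpha>, \<beta>) \<noteq> (0, 0)"
  using assms by (auto simp: plane_lines_def)

lemma plane_lines_inter:
  assumes "L1 \<in> plane_lines" "L2 \<in> plane_lines" "\<not> parallel_lines L1 L2" "z \<in> L1" "z \<in> L2"
  shows "z \<in> plane"
proof -
  obtain \<alpha> \<beta> \<gamma> where 1: "L1 = aline \<alpha> \<beta> \<gamma>" "\<alpha> \<in> R" "\<beta> \<in> R" "\<gamma> \<in> R" "(\<alpha>, \<beta>) \<noteq> (0, 0)"
    using assms(1) by (rule plane_linesE)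
  obtain \<alpha>' \<beta>' \<gamma>' where 2: "L2 = aline \<alpha>' \<beta>' \<gamma>'" "\<alpha>' \<in> R" "\<beta>' \<in> R" "\<gamma>' \<in> R" "(\<alpha>', \<beta>') \<noteq> (0, 0)"
    using assms(2) by (rule plane_linesE)
  \<comment> \<open>The determinant of Cramer's rule, nonzero because the lines are not
    parallel.\<close>
  define D where "D = \<alpha> * \<beta>' - \<alpha>' * \<beta>"
  have D: "D \<noteq> 0"
    using parallel_alines_iff[OF 1(5) 2(5)] assms(3-5) 1 2 by (auto simp: D_def)
  have z: "\<alpha> * Re z + \<beta> * Im z + \<gamma> = 0" "\<alpha>' * Re z + \<beta>' * Im z + \<gamma>' = 0"
    using assms 1 2 by (simp_all add: aline_iff)
  have "Re z * D = \<beta>' * (\<alpha> * Re z + \<beta> * Im z + \<gamma>) - \<beta> * (\<alpha>' * Re z + \<beta>' * Im z + \<gamma>')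
      + (\<beta> * \<gamma>' - \<beta>' * \<gamma>)"
    "Im z * D = \<alpha> * (\<alpha>' * Re z + \<beta>' * Im z + \<gamma>') - \<alpha>' * (\<alpha> * Re z + \<beta> * Im z + \<gamma>)
      + (\<alpha>' * \<gamma> - \<alpha> * \<gamma>')"
    by (simp_all add: D_def algebra_simps)
  then have "Re z * D = \<beta> * \<gamma>' - \<beta>' * \<gamma>" "Im z * D = \<alpha>' * \<gamma> - \<alpha> * \<gamma>'"
    unfolding z by simp_all
  then have "Re z = (\<beta> * \<gamma>' - \<beta>' * \<gamma>) / D" "Im z = (\<alpha>' * \<gamma> - \<alpha> * \<gamma>') / D"
    using D by (simp_all add: eq_divide_eq)
  then show ?thesis
    using 1 2 by (simp add: plane_def D_def closed)
qed

text \<open>After division by the lengths \<open>n\<close> and \<open>n'\<close> of the normals,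
  which lie in \<open>R\<close> by the Pythagorean property, the two equations are signed distances.
  Along \<open>L\<close> they are affine with equal absolute values, so they agree up to one sign,
  which yields an equation of \<open>L\<close> over \<open>R\<close>.\<close>

lemma plane_lines_bisector:
  assumes "L1 \<in> plane_lines" "L2 \<in> plane_lines" "L1 \<noteq> L2" "is_line L"
    and eqd: "\<And>z. z \<in> L \<Longrightarrow> infdist z L1 = infdist z L2"
  shows "L \<in> plane_lines"
proof -
  obtain \<alpha> \<beta> \<gamma> where 1: "L1 = aline \<alpha> \<beta> \<gamma>" "\<alpha> \<in> R" "\<beta> \<in> R" "\<gamma> \<in> R" "(\<alpha>, \<beta>) \<noteq> (0, 0)"
    using assms(1) by (rule plane_linesE)
  obtain \<alpha>' \<beta>' \<gamma>' where 2: "L2 = aline \<alpha>' \<beta>' \<gamma>'" "\<alpha>' \<in> R" "\<beta>' \<in> R" "\<gamma>' \<in> R" "(\<alpha>', \<beta>') \<noteq> (0, 0)"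
    using assms(2) by (rule plane_linesE)
  define n where "n = sqrt (\<alpha>\<^sup>2 + \<beta>\<^sup>2)"
  define n' where "n' = sqrt (\<alpha>'\<^sup>2 + \<beta>'\<^sup>2)"
  have n: "n \<in> R" "n > 0" "n' \<in> R" "n' > 0"
    using 1 2 sqrt_add_squares sum_squares_pos by (auto simp: n_def n'_def)
  define f where "f z = (\<alpha> * Re z + \<beta> * Im z + \<gamma>) / n" for z
  define f' where "f' z = (\<alpha>' * Re z + \<beta>' * Im z + \<gamma>') / n'" for z
  have infdist_f: "infdist z L1 = \<bar>f z\<bar>" "infdist z L2 = \<bar>f' z\<bar>" for z
    using n by (simp_all add: 1(1) 2(1) infdist_aline[OF 1(5)] infdist_aline[OF 2(5)]
        f_def f'_def abs_divide flip: n_def n'_def)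
  obtain a b where ab: "a \<noteq> b" "L = line_through a b"
    using assms(4) by (auto simp: is_line_def)
  have f_affine: "f (a + of_real t * (b - a)) = f a + t * (f b - f a)"
    "f' (a + of_real t * (b - a)) = f' a + t * (f' b - f' a)" for t
    using n by (simp_all add: f_def f'_def field_simps)
  have "\<bar>f a + t * (f b - f a)\<bar> = \<bar>f' a + t * (f' b - f' a)\<bar>" for t
  proof -
    have "a + of_real t * (b - a) \<in> L"
      using ab by (auto simp: line_through_def)
    then have "\<bar>f (a + of_real t * (b - a))\<bar> = \<bar>f' (a + of_real t * (b - a))\<bar>"
      using eqd infdist_f by metis
    then show ?thesis by (simp only: f_affine)
  qed
  then obtain \<epsilon> where \<epsilon>: "\<epsilon> = 1 \<or> \<epsilon> = - 1" "f a = \<epsilon> * f' a" "f b - f a = \<epsilon> * (f' b - f' a)"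
    by (rule abs_eq_affine_cases)
  then have fb: "f b = \<epsilon> * f' b" by (simp add: algebra_simps)
  define A where "A = \<alpha> / n - \<epsilon> * (\<alpha>' / n')"
  define B where "B = \<beta> / n - \<epsilon> * (\<beta>' / n')"
  define C where "C = \<gamma> / n - \<epsilon> * (\<gamma>' / n')"
  have ABC: "z \<in> aline A B C \<longleftrightarrow> f z = \<epsilon> * f' z" for z
    by (auto simp: aline_iff A_def B_def C_def f_def f'_def algebra_simps add_divide_distrib)
  have "\<epsilon> \<in> R" using \<epsilon>(1) closed by auto
  then have inR: "A \<in> R" "B \<in> R" "C \<in> R"
    using 1 2 n by (simp_all add: A_def B_def C_def closed)
  show ?thesis
  proof (cases "(A, B) = (0, 0)")
    case False
    have "L = aline A B C"
      using line_through_eq_aline[of a b A B C] ab \<epsilon> fb ABC False by simp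
    then show ?thesis using inR False plane_linesI by simp
  next
    \<comment> \<open>A trivial equation means that the signed distances agree up to sign
      everywhere; then both lines have the same points.\<close>
    case True
    then have "C = 0"
      using ABC[of a] \<epsilon>(2) by (simp add: aline_iff)
    then have "f z = \<epsilon> * f' z" for z
      using ABC[of z] True by (simp add: aline_iff)
    then have "f z = 0 \<longleftrightarrow> f' z = 0" for z
      using \<epsilon>(1) by auto
    then have "L1 = L2"
      using 1 2 n by (auto simp: aline_def f_def f'_def)
    then show ?thesis using assms(3) by simp
  qed
qed

lemma plane_lines_reflect:
  assumes "L1 \<in> plane_lines" "L2 \<in> plane_lines" "a \<noteq> b" "L1 = line_through a b"
  shows "reflect_across a b ` L2 \<in> plane_lines"
proof -
  obtain \<alpha> \<beta> \<gamma> where 1: "L1 = aline \<alpha> \<beta> \<gamma>" "\<alpha> \<in> R" "\<beta> \<in> R" "\<gamma> \<in> R" "(\<alpha>, \<beta>) \<noteq> (0, 0)"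
    using assms(1) by (rule plane_linesE)
  obtain \<alpha>' \<beta>' \<gamma>' where 2: "L2 = aline \<alpha>' \<beta>' \<gamma>'" "\<alpha>' \<in> R" "\<beta>' \<in> R" "\<gamma>' \<in> R" "(\<alpha>', \<beta>') \<noteq> (0, 0)"
    using assms(2) by (rule plane_linesE)
  have "a \<in> line_through a b" "b \<in> line_through a b"
    by (auto simp: line_through_def intro: exI[of _ 0] exI[of _ 1])
  then have ab: "a \<in> aline \<alpha> \<beta> \<gamma>" "b \<in> aline \<alpha> \<beta> \<gamma>"
    using 1 assms(4) by auto
  define k where "k = 2 * (\<alpha> * \<alpha>' + \<beta> * \<beta>') / (\<alpha>\<^sup>2 + \<beta>\<^sup>2)"
  have "k \<in> R" unfolding k_def using 1 2 by (intro closed)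
  \<comment> \<open>If the reflected normal vanished, the second normal would be \<open>k\<close>
    times the first, and the definition of \<open>k\<close> would give \<open>k = 2 * k\<close>.
    Then the second normal would be zero.\<close>
  moreover have "(\<alpha>' - k * \<alpha>, \<beta>' - k * \<beta>) \<noteq> (0, 0)"
  proof
    assume "(\<alpha>' - k * \<alpha>, \<beta>' - k * \<beta>) = (0, 0)"
    then have e: "\<alpha>' = k * \<alpha>" "\<beta>' = k * \<beta>" by auto
    then have S: "\<alpha> * \<alpha>' + \<beta> * \<beta>' = k * (\<alpha>\<^sup>2 + \<beta>\<^sup>2)"
      by (simp add: algebra_simps power2_eq_square)
    have M: "\<alpha>\<^sup>2 + \<beta>\<^sup>2 \<noteq> 0"
      using sum_squares_pos[OF 1(5)] by (rule less_imp_neq[symmetric])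
    then have "k * (\<alpha>\<^sup>2 + \<beta>\<^sup>2) = 2 * (\<alpha> * \<alpha>' + \<beta> * \<beta>')"
      using k_def by (metis nonzero_eq_divide_eq)
    then have "k * (\<alpha>\<^sup>2 + \<beta>\<^sup>2) = (2 * k) * (\<alpha>\<^sup>2 + \<beta>\<^sup>2)"
      unfolding S by (simp only: mult.assoc)
    then have "k = 2 * k"
      using M by (metis mult_right_cancel)
    then show False using e 2(5) by simp
  qed
  ultimately show ?thesis
    unfolding 2(1) reflect_across_aline[OF assms(3) ab 1(5)] k_def[symmetric]
    using 1 2 by (intro plane_linesI closed)
qed

lemma origami_closed_plane: "origami_closed plane"
  unfolding origami_closed_def
proof
  show "origami_pair plane plane_lines"
    unfolding origami_pair_def
  proof (intro conjI ballI allI impI)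
    show "is_line L" if "L \<in> plane_lines" for L
      using that is_line_aline by (auto simp: plane_lines_def)
    show "L1 \<inter> L2 \<subseteq> plane" if "L1 \<in> plane_lines" "L2 \<in> plane_lines" "\<not> parallel_lines L1 L2" for L1 L2
      using plane_lines_inter that by blast
    show "line_through a b \<in> plane_lines" if "a \<in> plane" "b \<in> plane" "a \<noteq> b" for a b
      unfolding line_through_aline[OF that(3)] using that
      by (intro plane_linesI) (auto simp: plane_def closed complex_eq_iff)
    show "perp_bisector a b \<in> plane_lines" if "a \<in> plane" "b \<in> plane" "a \<noteq> b" for a b
      unfolding perp_bisector_eq_aline using that
      by (intro plane_linesI) (auto simp: plane_def closed complex_eq_iff)
    show "L \<in> plane_lines" if "L1 \<in> plane_lines" "L2 \<in> plane_lines" "L1 \<noteq> L2"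
      "is_line L \<and> (\<forall>z\<in>L. infdist z L1 = infdist z L2)" for L1 L2 L
      using plane_lines_bisector that by blast
    show "reflect_across a b ` L2 \<in> plane_lines" if "L1 \<in> plane_lines" "L2 \<in> plane_lines"
      "a \<noteq> b \<and> L1 = line_through a b" for L1 L2 a b
      using plane_lines_reflect that by blast
  qed
qed

lemma origami_numbers_subset: "origami_numbers \<subseteq> R"
proof
  fix x assume "x \<in> origami_numbers"
  then obtain v w where vw: "v \<in> origami_points" "w \<in> origami_points" "\<bar>x\<bar> = dist v w"
    by (auto simp: origami_numbers_def)
  have "origami_points \<subseteq> plane"
    unfolding origami_points_def using origami_closed_plane
    by (intro Inter_lower) (simp add: plane_def zero one)
  then have "v \<in> plane" "w \<in> plane"
    using vw by auto
  then have "Re (v - w) \<in> R" "Im (v - w) \<in> R"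
    by (auto simp: plane_def diff)
  then have "\<bar>x\<bar> \<in> R"
    unfolding vw(3) dist_norm cmod_def by (rule sqrt_add_squares)
  then show "x \<in> R" by (simp only: abs_in_iff)
qed

end

section \<open>Coordinates in an arbitrary origami set\<close>

locale origami =
  fixes P :: "complex set" and \<L> :: "complex set set"
  assumes pair: "origami_pair P \<L>" and zero: "0 \<in> P" and ii: "\<i> \<in> P"
begin

lemmas pair_conjs = pair[unfolded origami_pair_def, THEN conjunct2]

lemma pair_inter: "L1 \<in> \<L> \<Longrightarrow> L2 \<in> \<L> \<Longrightarrow> \<not> parallel_lines L1 L2 \<Longrightarrow> L1 \<inter> L2 \<subseteq> P"
  using pair_conjs[THEN conjunct1] by blast

lemma pair_through: "a \<in> P \<Longrightarrow> b \<in> P \<Longrightarrow> a \<noteq> b \<Longrightarrow> line_through a b \<in> \<L>"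
  using pair_conjs[THEN conjunct2, THEN conjunct1] by blast

lemma pair_perp: "a \<in> P \<Longrightarrow> b \<in> P \<Longrightarrow> a \<noteq> b \<Longrightarrow> perp_bisector a b \<in> \<L>"
  using pair_conjs[THEN conjunct2, THEN conjunct2, THEN conjunct1] by blast

lemma pair_bisector:
  "L1 \<in> \<L> \<Longrightarrow> L2 \<in> \<L> \<Longrightarrow> L1 \<noteq> L2 \<Longrightarrow> is_line L \<Longrightarrow>
    \<forall>z\<in>L. infdist z L1 = infdist z L2 \<Longrightarrow> L \<in> \<L>"
  using pair_conjs[THEN conjunct2, THEN conjunct2, THEN conjunct2, THEN conjunct1] by blast

lemma pair_reflect:
  "line_through a b \<in> \<L> \<Longrightarrow> L2 \<in> \<L> \<Longrightarrow> a \<noteq> b \<Longrightarrow> reflect_across a b ` L2 \<in> \<L>"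
  using pair_conjs[THEN conjunct2, THEN conjunct2, THEN conjunct2, THEN conjunct2] by blast

lemma inter:
  assumes "aline \<alpha> \<beta> \<gamma> \<in> \<L>" "aline \<alpha>' \<beta>' \<gamma>' \<in> \<L>" "z \<in> aline \<alpha> \<beta> \<gamma>" "z \<in> aline \<alpha>' \<beta>' \<gamma>'"
    and "\<alpha> * \<beta>' \<noteq> \<alpha>' * \<beta>"
  shows "z \<in> P"
proof -
  have "(\<alpha>, \<beta>) \<noteq> (0, 0)" "(\<alpha>', \<beta>') \<noteq> (0, 0)" using assms(5) by auto
  then have "\<not> parallel_lines (aline \<alpha> \<beta> \<gamma>) (aline \<alpha>' \<beta>' \<gamma>')"
    using parallel_alines_iff assms(3-5) by blast
  then show ?thesis
    using pair_inter[OF assms(1,2)] assms(3,4) by blast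
qed

lemma through:
  assumes "a \<in> P" "b \<in> P" "a \<noteq> b" "a \<in> aline \<alpha> \<beta> \<gamma>" "b \<in> aline \<alpha> \<beta> \<gamma>" "(\<alpha>, \<beta>) \<noteq> (0, 0)"
  shows "aline \<alpha> \<beta> \<gamma> \<in> \<L>"
  using pair_through[OF assms(1-3)] line_through_eq_aline[OF assms(3-6)] by simp

lemma bisector_points:
  assumes "a \<in> P" "b \<in> P" "a \<noteq> b" "aline \<alpha> \<beta> \<gamma> = perp_bisector a b"
  shows "aline \<alpha> \<beta> \<gamma> \<in> \<L>"
  using pair_perp[OF assms(1-3)] assms(4) by simp

lemma bisector_lines:
  assumes "aline \<alpha> \<beta> \<gamma> \<in> \<L>" "aline \<alpha>' \<beta>' \<gamma>' \<in> \<L>" "aline \<alpha> \<beta> \<gamma> \<noteq> aline \<alpha>' \<beta>' \<gamma>'"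
    and "(\<alpha>, \<beta>) \<noteq> (0, 0)" "(\<alpha>', \<beta>') \<noteq> (0, 0)" "(A, B) \<noteq> (0, 0)"
    and "\<And>z. z \<in> aline A B C \<Longrightarrow> \<bar>\<alpha> * Re z + \<beta> * Im z + \<gamma>\<bar> / sqrt (\<alpha>\<^sup>2 + \<beta>\<^sup>2)
      = \<bar>\<alpha>' * Re z + \<beta>' * Im z + \<gamma>'\<bar> / sqrt (\<alpha>'\<^sup>2 + \<beta>'\<^sup>2)"
  shows "aline A B C \<in> \<L>"
proof -
  have "\<forall>z\<in>aline A B C. infdist z (aline \<alpha> \<beta> \<gamma>) = infdist z (aline \<alpha>' \<beta>' \<gamma>')"
    using assms by (simp add: infdist_aline)
  then show ?thesis
    using pair_bisector[OF assms(1-3) is_line_aline[OF assms(6)]] by blast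
qed

lemma reflect:
  assumes "aline \<alpha> \<beta> \<gamma> \<in> \<L>" "aline \<alpha>' \<beta>' \<gamma>' \<in> \<L>" "(\<alpha>, \<beta>) \<noteq> (0, 0)"
    and "k = 2 * (\<alpha> * \<alpha>' + \<beta> * \<beta>') / (\<alpha>\<^sup>2 + \<beta>\<^sup>2)"
  shows "aline (\<alpha>' - k * \<alpha>) (\<beta>' - k * \<beta>) (\<gamma>' - k * \<gamma>) \<in> \<L>"
proof -
  obtain a where a: "a \<in> aline \<alpha> \<beta> \<gamma>" "a + Complex (- \<beta>) \<alpha> \<in> aline \<alpha> \<beta> \<gamma>" "a + Complex (- \<beta>) \<alpha> \<noteq> a"
    using aline_points[OF assms(3), of \<gamma>] .
  let ?b = "a + Complex (- \<beta>) \<alpha>"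
  have "a \<noteq> ?b" using a(3) by auto
  then have "reflect_across a ?b ` aline \<alpha>' \<beta>' \<gamma>' \<in> \<L>"
    using pair_reflect[OF _ assms(2)] assms(1) line_through_eq_aline[OF \<open>a \<noteq> ?b\<close> a(1,2) assms(3)]
    by simp
  then show ?thesis
    unfolding reflect_across_aline[OF \<open>a \<noteq> ?b\<close> a(1,2) assms(3)] assms(4) .
qed

abbreviation "vline x \<equiv> aline 1 0 (- x)"
abbreviation "hline y \<equiv> aline 0 1 (- y)"

lemma reflect_vline: "vline a \<in> \<L> \<Longrightarrow> vline b \<in> \<L> \<Longrightarrow> vline (2 * a - b) \<in> \<L>"
  proof -
  assume "vline a \<in> \<L>" "vline b \<in> \<L>"
  then have "aline (1 - 2 * 1) (0 - 2 * 0) (- b - 2 * - a) \<in> \<L>"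
    by (rule reflect) auto
  moreover have "aline (1 - 2 * 1) (0 - 2 * 0) (- b - 2 * - a) = vline (2 * a - b)"
    by (auto simp: aline_iff)
  ultimately show ?thesis by simp
qed

lemma reflect_hline: "hline a \<in> \<L> \<Longrightarrow> hline b \<in> \<L> \<Longrightarrow> hline (2 * a - b) \<in> \<L>"
  proof -
  assume "hline a \<in> \<L>" "hline b \<in> \<L>"
  then have "aline (0 - 2 * 0) (1 - 2 * 1) (- b - 2 * - a) \<in> \<L>"
    by (rule reflect) auto
  moreover have "aline (0 - 2 * 0) (1 - 2 * 1) (- b - 2 * - a) = hline (2 * a - b)"
    by (auto simp: aline_iff)
  ultimately show ?thesis by simp
qed

lemma vline_0: "vline 0 \<in> \<L>"
  by (rule through[OF zero ii]) (auto simp: aline_iff)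

lemma midpoint_hline:
  assumes "Complex 0 a \<in> P" "Complex 0 b \<in> P" "a \<noteq> b"
  shows "hline ((a + b) / 2) \<in> \<L>"
proof (rule bisector_points[OF assms(1,2)])
  show "Complex 0 a \<noteq> Complex 0 b" using assms by simp
  show "hline ((a + b) / 2) = perp_bisector (Complex 0 a) (Complex 0 b)"
  proof -
    have "0 * x + 1 * y + - ((a + b) / 2) = 0 \<longleftrightarrow>
      2 * (0 - 0) * x + 2 * (b - a) * y + (0\<^sup>2 + a\<^sup>2 - 0\<^sup>2 - b\<^sup>2) = 0" for x y :: real
    proof -
      have "2 * (0 - 0) * x + 2 * (b - a) * y + (0\<^sup>2 + a\<^sup>2 - 0\<^sup>2 - b\<^sup>2) = 2 * (b - a) * (y - (a + b) / 2)"
        by (simp add: algebra_simps power2_eq_square add_divide_distrib)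
      then show ?thesis using assms(3) by auto
    qed
    then show ?thesis
      unfolding perp_bisector_eq_aline aline_def by simp
  qed
qed

lemma midpoint_vline:
  assumes "Complex a 0 \<in> P" "Complex b 0 \<in> P" "a \<noteq> b"
  shows "vline ((a + b) / 2) \<in> \<L>"
proof (rule bisector_points[OF assms(1,2)])
  show "Complex a 0 \<noteq> Complex b 0" using assms by simp
  show "vline ((a + b) / 2) = perp_bisector (Complex a 0) (Complex b 0)"
  proof -
    have "1 * x + 0 * y + - ((a + b) / 2) = 0 \<longleftrightarrow>
      2 * (b - a) * x + 2 * (0 - 0) * y + (a\<^sup>2 + 0\<^sup>2 - b\<^sup>2 - 0\<^sup>2) = 0" for x y :: real
    proof -
      have "2 * (b - a) * x + 2 * (0 - 0) * y + (a\<^sup>2 + 0\<^sup>2 - b\<^sup>2 - 0\<^sup>2) = 2 * (b - a) * (x - (a + b) / 2)"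
        by (simp add: algebra_simps power2_eq_square add_divide_distrib)
      then show ?thesis using assms(3) by auto
    qed
    then show ?thesis
      unfolding perp_bisector_eq_aline aline_def by simp
  qed
qed

lemma zero_Complex: "Complex 0 0 \<in> P" and ii_Complex: "Complex 0 1 \<in> P"
  using zero ii by (simp_all add: Complex_eq)

lemma hline_half: "hline (1 / 2) \<in> \<L>"
  using midpoint_hline[OF zero_Complex ii_Complex] by simp

text \<open>The horizontal axis has to be constructed: bisecting 0 and \<open>\<i>\<close> gives
  height 1/2, bisecting once more gives height 1/4, and reflecting the former line in the latter
  lands at height 0.\<close>

lemma hline_0: "hline 0 \<in> \<L>"
proof -
  have "Complex 0 (1 / 2) \<in> P"
    by (rule inter[OF vline_0 hline_half]) (auto simp: aline_iff)
  then have "hline (1 / 4) \<in> \<L>"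
    using midpoint_hline[OF zero_Complex] by fastforce
  then show ?thesis
    using reflect_hline[OF _ hline_half, of "1 / 4"] by simp
qed

lemma hline_1: "hline 1 \<in> \<L>"
  using reflect_hline[OF hline_half hline_0] by simp

lemma diagonal: "aline 1 (- 1) 0 \<in> \<L>"
proof (rule bisector_lines[OF vline_0 hline_0])
  have "1 \<in> hline 0" "1 \<notin> vline 0"
    by (auto simp: aline_iff)
  then show "vline 0 \<noteq> hline 0" by metis
qed (auto simp: aline_iff)

text \<open>Reflection in the diagonal exchanges the coordinates; here the factor \<open>k\<close>
  of \<open>reflect\<close> is 1 or -1.\<close>

lemma hline_iff_vline: "hline a \<in> \<L> \<longleftrightarrow> vline a \<in> \<L>"
  using reflect[OF diagonal, of 1 0 "- a" 1] reflect[OF diagonal, of 0 1 "- a" "- 1"] by auto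

text \<open>Coordinates are read off lines instead of points: intersecting a vertical with a
  horizontal line then gives any point with both coordinates in this set.\<close>

definition coords :: "real set" where
  "coords = {x. vline x \<in> \<L>}"

lemma coords_0: "0 \<in> coords" and coords_1: "1 \<in> coords"
  using vline_0 hline_1 by (auto simp: coords_def hline_iff_vline)

lemma point: "a \<in> coords \<Longrightarrow> b \<in> coords \<Longrightarrow> Complex a b \<in> P"
  by (rule inter[of 1 0 "- a" 0 1 "- b"]) (auto simp: aline_iff coords_def hline_iff_vline)

lemma coords_reflect: "a \<in> coords \<Longrightarrow> b \<in> coords \<Longrightarrow> 2 * a - b \<in> coords"
  unfolding coords_def mem_Collect_eq by (rule reflect_vline)

lemma coords_midpoint: "a \<in> coords \<Longrightarrow> b \<in> coords \<Longrightarrow> (a + b) / 2 \<in> coords"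
  using midpoint_vline[of a b] point[OF _ coords_0] by (cases "a = b") (auto simp: coords_def)

lemma coords_uminus: "a \<in> coords \<Longrightarrow> - a \<in> coords"
  using coords_reflect[OF coords_0, of a] by simp

text \<open>The sum is the mirror image of 0 in the midpoint.\<close>

lemma coords_add: "a \<in> coords \<Longrightarrow> b \<in> coords \<Longrightarrow> a + b \<in> coords"
  using coords_reflect[OF coords_midpoint coords_0, of a b] by (simp add: add_divide_distrib)

lemma coords_diff: "a \<in> coords \<Longrightarrow> b \<in> coords \<Longrightarrow> a - b \<in> coords"
  using coords_add[OF _ coords_uminus, of a b] by simp

text \<open>The bisector of the origin and the point is the vertical line at \<open>x / 2\<close>;
  reflecting the vertical axis in it reaches \<open>x\<close>.\<close>

lemma coords_if_point: "Complex x 0 \<in> P \<Longrightarrow> x \<in> coords"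
  using midpoint_vline[OF zero_Complex, of x] coords_reflect[OF _ coords_0, of "x / 2"] coords_0
  by (cases "x = 0") (auto simp: coords_def)

text \<open>The value is where the line meets the horizontal axis; the arithmetic constructions
  below read off their results this way.\<close>

lemma coords_hit:
  assumes "aline \<alpha> \<beta> \<gamma> \<in> \<L>" "\<alpha> \<noteq> 0"
  shows "- \<gamma> / \<alpha> \<in> coords"
  by (intro coords_if_point inter[OF assms(1) hline_0]) (use assms in \<open>auto simp: aline_iff\<close>)

text \<open>Similar triangles: the line through \<open>(0, q)\<close> and \<open>(r, q - 1)\<close>
  meets the axis at \<open>q * r\<close>. The two points differ in height, so \<open>r = 0\<close>
  is no exception.\<close>

lemma coords_mult:
  assumes "q \<in> coords" "r \<in> coords"
  shows "q * r \<in> coords"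
proof -
  have "aline 1 r (- r * q) \<in> \<L>"
    using assms by (intro through[OF point[of 0 q] point[of r "q - 1"]])
      (auto simp: aline_iff coords_0 coords_1 coords_diff algebra_simps)
  from coords_hit[OF this] show ?thesis by (simp add: mult.commute)
qed

text \<open>The line through \<open>(0, 1)\<close> and \<open>(- 1, 1 + t)\<close> has slope
  \<open>- t\<close> and meets the axis at \<open>1 / t\<close>.\<close>

lemma coords_inverse:
  assumes "t \<in> coords" "t \<noteq> 0"
  shows "inverse t \<in> coords"
proof -
  have "aline t 1 (- 1) \<in> \<L>"
    using assms by (intro through[OF point[of 0 1] point[of "- 1" "1 + t"]])
      (auto simp: aline_iff coords_0 coords_1 coords_add coords_uminus)
  from coords_hit[OF this] show ?thesis using assms by (simp add: divide_inverse)
qed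

text \<open>A bisector of the vertical axis and the line through \<open>(0, 1)\<close> and
  \<open>(x, 2)\<close> meets the horizontal axis at \<open>- x / (1 + s)\<close>, and field
  operations recover \<open>s\<close>. For \<open>x = 0\<close> the two lines coincide, hence the
  case split.\<close>

lemma coords_sqrt:
  assumes x: "x \<in> coords"
  shows "sqrt (1 + x\<^sup>2) \<in> coords"
proof (cases "x = 0")
  case True
  then show ?thesis by (simp add: coords_1)
next
  case False
  define s where "s = sqrt (1 + x\<^sup>2)"
  have s: "s > 0" by (simp add: s_def add_pos_nonneg)
  have slanted: "aline 1 (- x) x \<in> \<L>"
    using x coords_add[OF coords_1 coords_1]
    by (intro through[OF point[of 0 1] point[of x 2]]) (auto simp: aline_iff coords_0 coords_1 False)
  \<comment> \<open>On this line the slanted equation takes the value \<open>- s * Re z\<close>;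
    dividing by the length \<open>s\<close> of its normal leaves the distance to the vertical
    axis.\<close>
  have "aline (1 + s) (- x) x \<in> \<L>"
  proof (rule bisector_lines[OF vline_0 slanted])
    have "0 \<in> vline 0" "0 \<notin> aline 1 (- x) x"
      using False by (auto simp: aline_iff)
    then show "vline 0 \<noteq> aline 1 (- x) x" by metis
    fix z assume "z \<in> aline (1 + s) (- x) x"
    then have "1 * Re z + - x * Im z + x = - s * Re z"
      by (simp add: aline_iff algebra_simps)
    moreover have "sqrt (1\<^sup>2 + (- x)\<^sup>2) = s"
      by (simp add: s_def)
    ultimately show "\<bar>1 * Re z + 0 * Im z + - 0\<bar> / sqrt (1\<^sup>2 + 0\<^sup>2)
      = \<bar>1 * Re z + - x * Im z + x\<bar> / sqrt (1\<^sup>2 + (- x)\<^sup>2)"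
      using s by (simp only:) (simp add: abs_mult)
  qed (use False in auto)
  then have "- x / (1 + s) \<in> coords"
    using coords_hit s by fastforce
  then have "inverse (- x / (1 + s)) \<in> coords"
    using False s by (intro coords_inverse) auto
  then have "inverse (- x / (1 + s)) * - x \<in> coords"
    using coords_mult coords_uminus[OF x] by blast
  moreover have "inverse (- x / (1 + s)) * - x = 1 + s"
    using False by simp
  ultimately have "1 + s \<in> coords"
    by simp
  then show ?thesis
    using coords_diff[OF _ coords_1, of "1 + s"] by (simp add: s_def)
qed

lemma pythagorean_coords: "pythagorean (complex_of_real ` coords)"
  unfolding pythagorean_def
proof
  show "is_subfield (complex_of_real ` coords)"
    unfolding is_subfield_def
    by (auto simp flip: of_real_add of_real_diff of_real_mult of_real_inverse
        intro: coords_add coords_diff coords_mult coords_inverse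
          image_eqI[OF _ coords_0] image_eqI[OF _ coords_1])
  show "\<forall>x\<in>complex_of_real ` coords. \<exists>y\<in>complex_of_real ` coords. y\<^sup>2 = 1 + x\<^sup>2"
  proof
    fix x assume "x \<in> complex_of_real ` coords"
    then obtain r where r: "x = of_real r" "r \<in> coords" by blast
    have "(complex_of_real (sqrt (1 + r\<^sup>2)))\<^sup>2 = 1 + x\<^sup>2"
      by (simp add: r flip: of_real_power)
    then show "\<exists>y\<in>complex_of_real ` coords. y\<^sup>2 = 1 + x\<^sup>2"
      using coords_sqrt[OF r(2)] by blast
  qed
qed

lemma F_sqrt_1_plus_sq_subset: "F_sqrt_1_plus_sq \<subseteq> P"
proof -
  have "F_sqrt_1_plus_sq \<subseteq> complex_of_real ` coords"
    using pythagorean_coords by (auto simp: F_sqrt_1_plus_sq_eq)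
  also have "\<dots> \<subseteq> P"
    using point[OF _ coords_0] by (auto simp: Complex_eq)
  finally show ?thesis .
qed

end

section \<open>Origami numbers as the smallest Pythagorean field\<close>

lemma pythagorean_Reals: "pythagorean \<real>"
  unfolding pythagorean_def is_subfield_def
proof (intro conjI ballI impI)
  fix x :: complex assume "x \<in> \<real>"
  then obtain r where "x = of_real r" by (rule Reals_cases)
  then have "(complex_of_real (sqrt (1 + r\<^sup>2)))\<^sup>2 = 1 + x\<^sup>2"
    by (simp flip: of_real_power)
  then show "\<exists>y\<in>\<real>. y\<^sup>2 = 1 + x\<^sup>2" by (rule bexI) simp
qed auto

lemma F_sqrt_1_plus_sq_real: "F_sqrt_1_plus_sq \<subseteq> \<real>"
  using pythagorean_Reals by (auto simp: F_sqrt_1_plus_sq_eq)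

lemma F_sqrt_1_plus_sq_subset_origami_points: "F_sqrt_1_plus_sq \<subseteq> origami_points"
  unfolding origami_points_def
proof (rule Inter_greatest)
  fix P assume "P \<in> {P. 0 \<in> P \<and> \<i> \<in> P \<and> origami_closed P}"
  then obtain \<L> where "origami P \<L>"
    unfolding origami_closed_def origami_def by blast
  then show "F_sqrt_1_plus_sq \<subseteq> P"
    by (rule origami.F_sqrt_1_plus_sq_subset)
qed

text \<open>The plane over the field bounds the distances from above. Conversely an element
  \<open>r\<close> of the field is itself an origami point on the horizontal axis, at distance
  \<open>\<bar>r\<bar>\<close> from the origin.\<close>

lemma origami_numbers_eq: "complex_of_real ` origami_numbers = F_sqrt_1_plus_sq"
proof
  define R where "R = {x. complex_of_real x \<in> F_sqrt_1_plus_sq}"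
  have "complex_of_real ` R = F_sqrt_1_plus_sq"
    unfolding R_def using F_sqrt_1_plus_sq_real by (auto elim!: Reals_cases)
  moreover from this have "pythagorean_reals R"
    using pythagorean_F_sqrt_1_plus_sq by (simp add: pythagorean_reals_def)
  ultimately show "complex_of_real ` origami_numbers \<subseteq> F_sqrt_1_plus_sq"
    using pythagorean_reals.origami_numbers_subset by blast
  show "F_sqrt_1_plus_sq \<subseteq> complex_of_real ` origami_numbers"
  proof
    fix z assume z: "z \<in> F_sqrt_1_plus_sq"
    then obtain r where r: "z = of_real r"
      using F_sqrt_1_plus_sq_real Reals_cases by blast
    have "0 \<in> F_sqrt_1_plus_sq"
      using pythagorean_F_sqrt_1_plus_sq by (simp add: pythagorean_def subfield_0)
    then have "0 \<in> origami_points" "complex_of_real r \<in> origami_points"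
      using z r F_sqrt_1_plus_sq_subset_origami_points by auto
    moreover have "\<bar>r\<bar> = dist 0 (complex_of_real r)"
      by (simp add: dist_norm)
    ultimately have "r \<in> origami_numbers"
      unfolding origami_numbers_def by blast
    then show "z \<in> complex_of_real ` origami_numbers"
      using r by blast
  qed
qed

theorem mainTheorem11:
  shows "complex_of_real ` origami_numbers = F_sqrt_1_plus_sq
       \<and> F_sqrt_1_plus_sq = F_sqrt \<inter> F_TR"
  using origami_numbers_eq F_sqrt_1_plus_sq_eq_Int by simp

end
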